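(* Let $1 \to K \xrightarrow{i} \Gamma \xrightarrow{p} G \to 1$ be a group extension and let $\rho \colon \Gamma \to \mathrm{Homeo}_+(S^1)$ be a homomorphism whose Euler class $\rho^*e$ is contained in $\mathrm{Ker}\big(\mathrm{H}^2(\Gamma;\mathbb{Z}) \xrightarrow{i^*} \mathrm{H}^2(K;\mathbb{Z})\big)$. Let $\widetilde{\rho} \colon K \to \widetilde{\mathrm{Homeo}}_+(S^1)$ be a homomorphism lifting $\rho \circ i$ (such a lift exists by the assumption on $\rho^* e$), and let $k_{\widetilde{\rho}} \colon G \to \mathrm{H}^1(K;\mathbb{Z})$ be the crossed homomorphism determined by $$\big(k_{\widetilde{\rho}}(p(\gamma))\big)(x) = \tau(\widetilde{\rho}(x)) - \tau(\widetilde{\rho}(\gamma^{-1}x\gamma)) \qquad (\gamma \in \Gamma,\ x \in K).$$ Then $[k_{\widetilde{\rho}}] = \phi(\rho^*e)$ in $\mathrm{H}^1(G;\mathrm{H}^1(K;\mathbb{Z}))$, where $\phi \colon \mathrm{Ker}\big(\mathrm{H}^2(\Gamma;\mathbb{Z}) \xrightarrow{i^*} \mathrm{H}^2(K;\mathbb{Z})\big) \to \mathrm{H}^1(G;\mathrm{H}^1(K;\mathbb{Z}))$ is the map in the seven-term exact sequence of the extension. In particular, the class $[k_{\widetilde{\rho}}]$ depends only on the semi-conjugacy class of $\rho$: if $\rho_1,\rho_2 \colon \Gamma \to \mathrm{Homeo}_+(S^1)$ are semi-conjugate homomorphisms whose Euler classes lie in $\mathrm{Ker}(i^* )$, and $\widetilde{\rho}_1,\widetilde{\rho}_2$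 are any lifts of $\rho_1\circ i,\rho_2\circ i$ respectively, then $[k_{\widetilde{\rho}_1}] = [k_{\widetilde{\rho}_2}]$.
   Context: $\mathrm{Homeo}_+(S^1)$ is the (abstract) group of orientation-preserving homeomorphisms of the circle $S^1=\mathbb{R}/\mathbb{Z}$. Its universal covering group is $\widetilde{\mathrm{Homeo}}_+(S^1) = \{ f \in \mathrm{Homeo}(\mathbb{R}) : f \circ T = T \circ f\}$, where $T(t)=t+1$; it projects onto $\mathrm{Homeo}_+(S^1)$ with central kernel generated by $T$. The Poincaré translation number is $\tau \colon \widetilde{\mathrm{Homeo}}_+(S^1) \to \mathbb{R}$, $\tau(f) = \lim_{n\to\infty} f^n(0)/n$. Group cohomology is that of abstract groups, computed by inhomogeneous cochains, with coboundary $\delta c(g_1,\dots,g_{n+1}) = {}^{g_1}(c(g_2,\dots,g_{n+1})) + \sum_{i=1}^n (-1)^i c(g_1,\dots,g_ig_{i+1},\dots,g_{n+1}) + (-1)^{n+1}c(g_1,\dots,g_n)$. A crossed homomorphism $k\colon G\to M$ (for a left $G$-module $M$) is a map with $k(g_1g_2)=k(g_1)+{}^{g_1}(k(g_2))$, i.e. a $1$-cocycle. The integral Euler class $e$ is the generator of $\mathrm{H}^2(\mathrm{Homeo}_+(S^1);\mathbb{Z})\cong\mathbb{Z}$ represented by the integer-valued cocycle $\chi_{\mathbb{Z}}(f,g) = \lfloor \tau(\tilde f\tilde g)\rfloor - \lfloor\tau(\tilde f)\rfloor - \lfloor\tau(\tilde g)\rfloor$, where $\tilde f,\tilde g$ are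 arbitrary lifts of $f,g$ to $\widetilde{\mathrm{Homeo}}_+(S^1)$ (the value does not depend on the lifts). The Euler class of $\rho$ is $\rho^*e \in \mathrm{H}^2(\Gamma;\mathbb{Z})$. $\mathbb{Z}$ is a trivial module, $K$ is identified with $i(K)\subset\Gamma$, $\mathrm{H}^1(K;\mathbb{Z})=\mathrm{Hom}(K,\mathbb{Z})$, and $\Gamma$ acts on it on the left by $({}^{\gamma}h)(x)=h(\gamma^{-1}x\gamma)$; this action factors through $G$. The formula for $k_{\widetilde{\rho}}$ is a well-defined crossed homomorphism $G\to \mathrm{H}^1(K;\mathbb{Z})$ with respect to this action. The map $\phi$ is the one in the seven-term exact sequence $0 \to \mathrm{H}^1(G;\mathbb{Z}) \to \mathrm{H}^1(\Gamma;\mathbb{Z}) \to \mathrm{H}^1(K;\mathbb{Z})^{\Gamma} \to \mathrm{H}^2(G;\mathbb{Z}) \to \mathrm{Ker}(i^* ) \xrightarrow{\phi} \mathrm{H}^1(G;\mathrm{H}^1(K;\mathbb{Z})) \to \mathrm{H}^3(G;\mathbb{Z})$ obtained from the Hochschild–Serre spectral sequence. Explicitly: let $A_1^{*2}$ be the group of normalized $2$-cochains $f\colon\Gamma^2\to\mathbb{Z}$ (i.e. $f(\gamma_1,\gamma_2)=0$ if $\gamma_1=1$ or $\gamma_2=1$) such that $f(\gamma_1,\gamma_2)$ depends only on $\gamma_1\in\Gamma$ and $p(\gamma_2)\in G$. Every class $c\in\mathrm{Ker}(i^* )$ is represented by a cocycle $f\in A_1^{*2}$, and $\phi(c)=[\mathfrak{K}_f]$,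 where $\mathfrak{K}_f\colon G\to \mathrm{H}^1(K;\mathbb{Z})$ is the crossed homomorphism $\big(\mathfrak{K}_f(p(\gamma))\big)(x)=f(x,\gamma)$ for $\gamma\in\Gamma$, $x\in K$; the resulting class is independent of the choice of $f$. Semi-conjugacy (standard notion): $\rho_1,\rho_2\colon\Gamma\to\mathrm{Homeo}_+(S^1)$ are semi-conjugate if there is a non-decreasing (not necessarily continuous) map $h\colon\mathbb{R}\to\mathbb{R}$ with $h\circ T=T\circ h$ such that for every $\gamma\in\Gamma$ there are lifts $\tilde f_1,\tilde f_2\in\widetilde{\mathrm{Homeo}}_+(S^1)$ of $\rho_1(\gamma),\rho_2(\gamma)$ with $\tilde f_1\circ h=h\circ\tilde f_2$. *)

theory Defs
  imports
    "HOL-Analysis.Analysis"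
    "HOL-Algebra.Coset"
    "HOL-Algebra.FiniteProduct"
    "HOL-Algebra.Elementary_Groups"
    "HOL-Algebra.Product_Groups"
begin

section \<open>Group cohomology by inhomogeneous cochains\<close>

text \<open>
  A left \<open>G\<close>-module is an abelian group \<open>M\<close> in the sense of HOL-Algebra (hence written
  multiplicatively) together with an action \<open>a :: 'g \<Rightarrow> 'm \<Rightarrow> 'm\<close>.  An \<open>n\<close>-cochain is an
  extensional function on the lists of length \<open>n\<close> over \<open>carrier G\<close>.
\<close>

definition tuples :: "('g, 'x) monoid_scheme \<Rightarrow> nat \<Rightarrow> 'g list set" where
  "tuples G n = {gs. length gs = n \<and> set gs \<subseteq> carrier G}"

definition cochain_group ::
    "('g, 'x) monoid_scheme \<Rightarrow> ('m, 'y) monoid_scheme \<Rightarrow> nat \<Rightarrow> ('g list \<Rightarrow> 'm) monoid" where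
  "cochain_group G M n = product_group (tuples G n) (\<lambda>_. M)"

text \<open>\<open>merge_at G i [g\<^sub>1, \<dots>] = [g\<^sub>1, \<dots>, g\<^sub>i g\<^sub>i\<^sub>+\<^sub>1, \<dots>]\<close>, with \<open>i\<close> counted from 1.\<close>

definition merge_at :: "('g, 'x) monoid_scheme \<Rightarrow> nat \<Rightarrow> 'g list \<Rightarrow> 'g list" where
  "merge_at G i gs = take (i - 1) gs @ [gs ! (i - 1) \<otimes>\<^bsub>G\<^esub> gs ! i] @ drop (i + 1) gs"

definition coboundary ::
    "('g, 'x) monoid_scheme \<Rightarrow> ('m, 'y) monoid_scheme \<Rightarrow> ('g \<Rightarrow> 'm \<Rightarrow> 'm) \<Rightarrow> nat
      \<Rightarrow> ('g list \<Rightarrow> 'm) \<Rightarrow> 'g list \<Rightarrow> 'm" where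
  "coboundary G M a n c = (\<lambda>gs \<in> tuples G (n + 1).
     a (hd gs) (c (tl gs))
     \<otimes>\<^bsub>M\<^esub> (\<Otimes>\<^bsub>M\<^esub>i \<in> {1..n}. c (merge_at G i gs) [^]\<^bsub>M\<^esub> ((- 1) ^ i :: int))
     \<otimes>\<^bsub>M\<^esub> c (butlast gs) [^]\<^bsub>M\<^esub> ((- 1) ^ (n + 1) :: int))"

definition cocycles ::
    "('g, 'x) monoid_scheme \<Rightarrow> ('m, 'y) monoid_scheme \<Rightarrow> ('g \<Rightarrow> 'm \<Rightarrow> 'm) \<Rightarrow> nat
      \<Rightarrow> ('g list \<Rightarrow> 'm) set" where
  "cocycles G M a n = kernel (cochain_group G M n) (cochain_group G M (n + 1)) (coboundary G M a n)"

definition coboundaries ::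
    "('g, 'x) monoid_scheme \<Rightarrow> ('m, 'y) monoid_scheme \<Rightarrow> ('g \<Rightarrow> 'm \<Rightarrow> 'm) \<Rightarrow> nat
      \<Rightarrow> ('g list \<Rightarrow> 'm) set" where
  "coboundaries G M a n =
     (if n = 0 then {\<one>\<^bsub>cochain_group G M 0\<^esub>}
      else coboundary G M a (n - 1) ` carrier (cochain_group G M (n - 1)))"

definition cohomology ::
    "('g, 'x) monoid_scheme \<Rightarrow> ('m, 'y) monoid_scheme \<Rightarrow> ('g \<Rightarrow> 'm \<Rightarrow> 'm) \<Rightarrow> nat
      \<Rightarrow> ('g list \<Rightarrow> 'm) set monoid" where
  "cohomology G M a n =
     (cochain_group G M n)\<lparr>carrier := cocycles G M a n\<rparr> Mod coboundaries G M a n"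

definition cohomology_class ::
    "('g, 'x) monoid_scheme \<Rightarrow> ('m, 'y) monoid_scheme \<Rightarrow> ('g \<Rightarrow> 'm \<Rightarrow> 'm) \<Rightarrow> nat
      \<Rightarrow> ('g list \<Rightarrow> 'm) \<Rightarrow> ('g list \<Rightarrow> 'm) set" where
  "cohomology_class G M a n c = coboundaries G M a n #>\<^bsub>cochain_group G M n\<^esub> c"

definition trivial_action :: "'g \<Rightarrow> 'm \<Rightarrow> 'm" where
  "trivial_action g m = m"

text \<open>
  The map \<open>\<phi>\<^sup>*\<close> induced on cohomology with trivial coefficients by a homomorphism \<open>\<phi>\<close> with
  domain \<open>H\<close>; the class of the pulled back cocycle is the same for all representatives
  \<open>c\<close> of \<open>C\<close>.
\<close>

definition pullback ::
    "('h, 'x) monoid_scheme \<Rightarrow> ('m, 'y) monoid_scheme \<Rightarrow> nat \<Rightarrow> ('h \<Rightarrow> 'g)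
      \<Rightarrow> ('g list \<Rightarrow> 'm) set \<Rightarrow> ('h list \<Rightarrow> 'm) set" where
  "pullback H M n \<phi> C =
     (THE D. \<exists>c \<in> C. D = cohomology_class H M trivial_action n (\<lambda>hs \<in> tuples H n. c (map \<phi> hs)))"

definition crossed_homs ::
    "('g, 'x) monoid_scheme \<Rightarrow> ('m, 'y) monoid_scheme \<Rightarrow> ('g \<Rightarrow> 'm \<Rightarrow> 'm) \<Rightarrow> ('g \<Rightarrow> 'm) set" where
  "crossed_homs G M a =
     {k \<in> carrier G \<rightarrow>\<^sub>E carrier M.
        \<forall>g \<in> carrier G. \<forall>h \<in> carrier G. k (g \<otimes>\<^bsub>G\<^esub> h) = k g \<otimes>\<^bsub>M\<^esub> a g (k h)}"

definition crossed_hom_class ::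
    "('g, 'x) monoid_scheme \<Rightarrow> ('m, 'y) monoid_scheme \<Rightarrow> ('g \<Rightarrow> 'm \<Rightarrow> 'm) \<Rightarrow> ('g \<Rightarrow> 'm)
      \<Rightarrow> ('g list \<Rightarrow> 'm) set" where
  "crossed_hom_class G M a k = cohomology_class G M a 1 (\<lambda>gs \<in> tuples G 1. k (hd gs))"

section \<open>Group extensions and the map \<open>\<phi>\<close> of the seven-term exact sequence\<close>

locale group_extension =
  fixes K :: "'k monoid" and \<Gamma> :: "'g monoid" and G :: "'q monoid"
    and i :: "'k \<Rightarrow> 'g" and p :: "'g \<Rightarrow> 'q"
  assumes group_K: "group K" and group_\<Gamma>: "group \<Gamma>" and group_G: "group G"
    and i_mon: "i \<in> mon K \<Gamma>"
    and p_epi: "p \<in> epi \<Gamma> G"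
    and exact: "i ` carrier K = kernel \<Gamma> G p"

text \<open>\<open>H\<^sup>1(K;\<int>) = Hom(K,\<int>)\<close>, with pointwise addition.\<close>

definition H1_int :: "'k monoid \<Rightarrow> ('k \<Rightarrow> int) monoid" where
  "H1_int K = (product_group (carrier K) (\<lambda>_. integer_group))
     \<lparr>carrier := hom K integer_group \<inter> extensional (carrier K)\<rparr>"

text \<open>The element of \<open>K\<close> that \<open>i\<close> maps to \<open>\<gamma>\<inverse> i(x) \<gamma>\<close>.\<close>

definition conj_by :: "'k monoid \<Rightarrow> 'g monoid \<Rightarrow> ('k \<Rightarrow> 'g) \<Rightarrow> 'g \<Rightarrow> 'k \<Rightarrow> 'k" where
  "conj_by K \<Gamma> i \<gamma> x = inv_into (carrier K) i (inv\<^bsub>\<Gamma>\<^esub> \<gamma> \<otimes>\<^bsub>\<Gamma>\<^esub> i x \<otimes>\<^bsub>\<Gamma>\<^esub> \<gamma>)"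

text \<open>
  The action of \<open>\<Gamma>\<close> on \<open>H\<^sup>1(K;\<int>)\<close>, and the action of \<open>G\<close> through which it factors: since \<open>K\<close>
  acts trivially, the latter does not depend on the preimage of \<open>g\<close> that is picked.
\<close>

definition \<Gamma>_action :: "'k monoid \<Rightarrow> 'g monoid \<Rightarrow> ('k \<Rightarrow> 'g) \<Rightarrow> 'g \<Rightarrow> ('k \<Rightarrow> int) \<Rightarrow> 'k \<Rightarrow> int" where
  "\<Gamma>_action K \<Gamma> i \<gamma> h = (\<lambda>x \<in> carrier K. h (conj_by K \<Gamma> i \<gamma> x))"

definition G_action ::
    "'k monoid \<Rightarrow> 'g monoid \<Rightarrow> ('k \<Rightarrow> 'g) \<Rightarrow> ('g \<Rightarrow> 'q) \<Rightarrow> 'q \<Rightarrow> ('k \<Rightarrow> int) \<Rightarrow> 'k \<Rightarrow> int" where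
  "G_action K \<Gamma> i p g = \<Gamma>_action K \<Gamma> i (inv_into (carrier \<Gamma>) p g)"

text \<open>\<open>Ker (i\<^sup>* : H\<^sup>2(\<Gamma>;\<int>) \<rightarrow> H\<^sup>2(K;\<int>))\<close>\<close>

definition Ker_res :: "'k monoid \<Rightarrow> 'g monoid \<Rightarrow> ('k \<Rightarrow> 'g) \<Rightarrow> ('g list \<Rightarrow> int) set set" where
  "Ker_res K \<Gamma> i = kernel (cohomology \<Gamma> integer_group trivial_action 2)
     (cohomology K integer_group trivial_action 2) (pullback K integer_group 2 i)"

text \<open>
  \<open>A12\<close> is the group of normalized 2-cochains on \<open>\<Gamma>\<close> that depend on the second argument only
  through \<open>p\<close>; accordingly \<open>A12_crossed_hom\<close> may evaluate at any preimage of \<open>g\<close>.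
\<close>

definition A12 :: "'g monoid \<Rightarrow> ('g \<Rightarrow> 'q) \<Rightarrow> ('g list \<Rightarrow> int) set" where
  "A12 \<Gamma> p = {f \<in> carrier (cochain_group \<Gamma> integer_group 2).
     (\<forall>\<gamma> \<in> carrier \<Gamma>. f [\<one>\<^bsub>\<Gamma>\<^esub>, \<gamma>] = 0 \<and> f [\<gamma>, \<one>\<^bsub>\<Gamma>\<^esub>] = 0) \<and>
     (\<forall>\<gamma> \<in> carrier \<Gamma>. \<forall>\<beta> \<in> carrier \<Gamma>. \<forall>\<beta>' \<in> carrier \<Gamma>. p \<beta> = p \<beta>' \<longrightarrow> f [\<gamma>, \<beta>] = f [\<gamma>, \<beta>'])}"

definition A12_crossed_hom ::
    "'k monoid \<Rightarrow> 'g monoid \<Rightarrow> 'q monoid \<Rightarrow> ('k \<Rightarrow> 'g) \<Rightarrow> ('g \<Rightarrow> 'q) \<Rightarrow> ('g list \<Rightarrow> int)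
      \<Rightarrow> 'q \<Rightarrow> 'k \<Rightarrow> int" where
  "A12_crossed_hom K \<Gamma> G i p f =
     (\<lambda>g \<in> carrier G. \<lambda>x \<in> carrier K. f [i x, inv_into (carrier \<Gamma>) p g])"

definition seven_term_phi ::
    "'k monoid \<Rightarrow> 'g monoid \<Rightarrow> 'q monoid \<Rightarrow> ('k \<Rightarrow> 'g) \<Rightarrow> ('g \<Rightarrow> 'q) \<Rightarrow> ('g list \<Rightarrow> int) set
      \<Rightarrow> ('q list \<Rightarrow> 'k \<Rightarrow> int) set" where
  "seven_term_phi K \<Gamma> G i p C =
     (THE D. \<exists>f \<in> C \<inter> A12 \<Gamma> p.
        D = crossed_hom_class G (H1_int K) (G_action K \<Gamma> i p) (A12_crossed_hom K \<Gamma> G i p f))"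

section \<open>Homeomorphisms of the circle\<close>

quotient_type circle = real / "\<lambda>s t :: real. s - t \<in> \<int>"
  morphisms rep_circle proj_circle
proof (rule equivpI)
  show "reflp (\<lambda>s t :: real. s - t \<in> \<int>)" by (auto simp: reflp_def)
  show "symp (\<lambda>s t :: real. s - t \<in> \<int>)"
    by (metis (no_types, lifting) Ints_minus minus_diff_eq sympI)
  show "transp (\<lambda>s t :: real. s - t \<in> \<int>)"
    by (rule transpI) (metis (no_types, lifting) Ints_add add_diff_cancel_right' diff_add_cancel add_diff_eq)
qed

instantiation circle :: topological_space
begin

definition open_circle :: "circle set \<Rightarrow> bool" where
  "open_circle U \<longleftrightarrow> open (proj_circle -` U)"

instance
  by standard (auto simp: open_circle_def vimage_Union intro!: open_Int)

end

definition homeos :: "('a::topological_space \<Rightarrow> 'a) set" where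
  "homeos = {f. \<exists>g. homeomorphism UNIV UNIV f g}"

definition shift :: "real \<Rightarrow> real" where
  "shift t = t + 1"

text \<open>\<open>Homeo\<^sub>+(S\<^sup>1)\<close>; orientation-preserving means that some continuous lift to \<open>\<real>\<close> is increasing.\<close>

definition Homeo_plus :: "(circle \<Rightarrow> circle) monoid" where
  "Homeo_plus =
     \<lparr>carrier = {f \<in> homeos. \<exists>F :: real \<Rightarrow> real.
        continuous_on UNIV F \<and> strict_mono F \<and> proj_circle \<circ> F = f \<circ> proj_circle},
      mult = (\<circ>), one = id\<rparr>"

definition Homeo_cover :: "(real \<Rightarrow> real) monoid" where
  "Homeo_cover = \<lparr>carrier = {F \<in> homeos. F \<circ> shift = shift \<circ> F}, mult = (\<circ>), one = id\<rparr>"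

definition is_lift :: "(real \<Rightarrow> real) \<Rightarrow> (circle \<Rightarrow> circle) \<Rightarrow> bool" where
  "is_lift F f \<longleftrightarrow> F \<in> carrier Homeo_cover \<and> proj_circle \<circ> F = f \<circ> proj_circle"

definition translation_number :: "(real \<Rightarrow> real) \<Rightarrow> real" where
  "translation_number F = lim (\<lambda>n. (F ^^ n) 0 / real n)"

text \<open>The cocycle representing the Euler class; its value does not depend on the lifts that are picked.\<close>

definition some_lift :: "(circle \<Rightarrow> circle) \<Rightarrow> real \<Rightarrow> real" where
  "some_lift f = (SOME F. is_lift F f)"

definition euler_cocycle :: "(circle \<Rightarrow> circle) list \<Rightarrow> int" where
  "euler_cocycle = (\<lambda>fs \<in> tuples Homeo_plus 2.
     let F = some_lift (fs ! 0); H = some_lift (fs ! 1)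
     in \<lfloor>translation_number (F \<circ> H)\<rfloor> - \<lfloor>translation_number F\<rfloor> - \<lfloor>translation_number H\<rfloor>)"

definition euler_class :: "((circle \<Rightarrow> circle) list \<Rightarrow> int) set" where
  "euler_class = cohomology_class Homeo_plus integer_group trivial_action 2 euler_cocycle"

definition euler_class_of :: "'g monoid \<Rightarrow> ('g \<Rightarrow> circle \<Rightarrow> circle) \<Rightarrow> ('g list \<Rightarrow> int) set" where
  "euler_class_of \<Gamma> \<rho> = pullback \<Gamma> integer_group 2 \<rho> euler_class"

definition lifts_hom ::
    "'k monoid \<Rightarrow> ('k \<Rightarrow> circle \<Rightarrow> circle) \<Rightarrow> ('k \<Rightarrow> real \<Rightarrow> real) \<Rightarrow> bool" where
  "lifts_hom K \<sigma> \<sigma>' \<longleftrightarrow> \<sigma>' \<in> hom K Homeo_cover \<and> (\<forall>x \<in> carrier K. is_lift (\<sigma>' x) (\<sigma> x))"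

text \<open>
  \<open>k\<close> is the crossed homomorphism \<open>G \<rightarrow> H\<^sup>1(K;\<int>)\<close> determined by the homomorphism \<open>\<sigma>\<close> from
  \<open>K\<close> to the universal covering group.  Integrality of the difference of translation numbers
  is part of the existence of \<open>k\<close>.
\<close>

definition is_translation_crossed_hom ::
    "'k monoid \<Rightarrow> 'g monoid \<Rightarrow> 'q monoid \<Rightarrow> ('k \<Rightarrow> 'g) \<Rightarrow> ('g \<Rightarrow> 'q) \<Rightarrow> ('k \<Rightarrow> real \<Rightarrow> real)
      \<Rightarrow> ('q \<Rightarrow> 'k \<Rightarrow> int) \<Rightarrow> bool" where
  "is_translation_crossed_hom K \<Gamma> G i p \<sigma> k \<longleftrightarrow>
     k \<in> crossed_homs G (H1_int K) (G_action K \<Gamma> i p) \<and>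
     (\<forall>\<gamma> \<in> carrier \<Gamma>. \<forall>x \<in> carrier K.
        real_of_int (k (p \<gamma>) x) =
          translation_number (\<sigma> x) - translation_number (\<sigma> (conj_by K \<Gamma> i \<gamma> x)))"

definition semi_conjugate ::
    "'g monoid \<Rightarrow> ('g \<Rightarrow> circle \<Rightarrow> circle) \<Rightarrow> ('g \<Rightarrow> circle \<Rightarrow> circle) \<Rightarrow> bool" where
  "semi_conjugate \<Gamma> \<rho>\<^sub>1 \<rho>\<^sub>2 \<longleftrightarrow>
     (\<exists>h :: real \<Rightarrow> real. mono h \<and> h \<circ> shift = shift \<circ> h \<and>
        (\<forall>\<gamma> \<in> carrier \<Gamma>. \<exists>F\<^sub>1 F\<^sub>2. is_lift F\<^sub>1 (\<rho>\<^sub>1 \<gamma>) \<and> is_lift F\<^sub>2 (\<rho>\<^sub>2 \<gamma>) \<and> F\<^sub>1 \<circ> h = h \<circ> F\<^sub>2))"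

end

theory Submission
  imports Defs
begin

text \<open>
  Choose lifts \<open>\<sigma>(\<gamma>)\<close> of the \<open>\<rho>(\<gamma>)\<close> with \<open>\<sigma>(1) = id\<close> and \<open>\<sigma>(\<gamma> x) = \<sigma>(\<gamma>) \<rho>'(x)\<close> for \<open>x \<in> K\<close>. The cocycle
  \<open>f\<close> with \<open>\<sigma>(\<gamma>\<^sub>1) \<sigma>(\<gamma>\<^sub>2) = T\<^bsup>f(\<gamma>\<^sub>1,\<gamma>\<^sub>2)\<^esup> \<sigma>(\<gamma>\<^sub>1 \<gamma>\<^sub>2)\<close> represents the Euler class and lies in \<open>A12\<close>. From
  \<open>x \<gamma> = \<gamma> (\<gamma>\<inverse> x \<gamma>)\<close> one gets \<open>\<rho>'(x) \<sigma>(\<gamma>) = T\<^bsup>f(x,\<gamma>)\<^esup> \<sigma>(\<gamma>) \<rho>'(\<gamma>\<inverse> x \<gamma>)\<close>, and invariance of the translation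
  number under conjugation identifies \<open>f(x,\<gamma>)\<close> with the difference of translation numbers. The
  second part does not pass through the Euler class: semi-conjugacy preserves translation numbers,
  so the two crossed homomorphisms differ by a principal one.
\<close>

section \<open>Translation numbers of monotone maps of degree one\<close>

text \<open>Neither strictness nor continuity is asked, so that lifts of circle homeomorphisms and
  the map \<open>h\<close> of a semi-conjugacy are both covered.\<close>

definition degree_one :: "(real \<Rightarrow> real) \<Rightarrow> bool" where
  "degree_one F \<longleftrightarrow> mono F \<and> F \<circ> shift = shift \<circ> F"

lemma degree_one_mono: "degree_one F \<Longrightarrow> s \<le> t \<Longrightarrow> F s \<le> F t"
  by (simp add: degree_one_def monoD)

text \<open>Separated from \<open>degree_one\<close> because \<open>Homeo_cover_iff\<close> applies
  it before monotonicity is known.\<close>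

lemma commutes_shift_of_int:
  assumes "F \<circ> shift = shift \<circ> F"
  shows "F (t + of_int n) = F t + of_int n"
proof -
  have 1: "F (t + 1) = F t + 1" for t
    using fun_cong[OF assms, of t] by (simp add: shift_def)
  show ?thesis
  proof (induction n rule: int_induct[where k = 0])
    case (step1 i)
    then show ?case using 1[of "t + of_int i"] by (simp add: add.assoc)
  next
    case (step2 i)
    then show ?case using 1[of "t + of_int (i - 1)"] by (simp add: algebra_simps)
  qed simp
qed

lemma degree_one_of_int: "degree_one F \<Longrightarrow> F (t + of_int n) = F t + of_int n"
  by (simp add: degree_one_def commutes_shift_of_int)

lemma degree_one_id: "degree_one id"
  by (simp add: degree_one_def mono_def)

lemma degree_one_comp:
  assumes "degree_one F" "degree_one H"
  shows "degree_one (F \<circ> H)"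
proof -
  have "F (H (t + 1)) = F (H t) + 1" for t
    using degree_one_of_int[OF assms(2), of t 1] degree_one_of_int[OF assms(1), of "H t" 1] by simp
  then show ?thesis
    using assms by (auto simp: degree_one_def mono_def shift_def)
qed

lemma degree_one_funpow: "degree_one F \<Longrightarrow> degree_one (F ^^ n)"
  by (induction n) (use degree_one_id degree_one_comp in \<open>auto simp: id_def\<close>)

text \<open>Subtracting the integer part of \<open>t\<close> reduces the claim to
  \<open>0 \<le> t < 1\<close>. There \<open>F t - F 0\<close> lies between 0 and
  \<open>F 1 - F 0 = 1\<close>, as does \<open>t\<close>.\<close>

lemma degree_one_displacement:
  assumes "degree_one F"
  shows "\<bar>F t - t - F 0\<bar> \<le> 1"
proof -
  have "F t = F (frac t) + of_int \<lfloor>t\<rfloor>"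
    using degree_one_of_int[OF assms, of "frac t" "\<lfloor>t\<rfloor>"] by (simp add: frac_def)
  moreover have "F 0 \<le> F (frac t)" "F (frac t) \<le> F 1"
    using frac_lt_1[of t] by (auto intro!: degree_one_mono[OF assms])
  moreover have "F 1 = F 0 + 1"
    using degree_one_of_int[OF assms, of 0 1] by simp
  ultimately show ?thesis
    using frac_lt_1[of t] frac_ge_0[of t] unfolding frac_def by linarith
qed

text \<open>The orbit of 0 is additive in the exponent up to an error of 1, which makes the
  quotients a Cauchy sequence. Only with this convergence does the \<open>lim\<close> in
  \<open>translation_number\<close> carry information.\<close>

lemma translation_number_tendsto:
  assumes "degree_one F"
  shows "(\<lambda>n. (F ^^ n) 0 / real n) \<longlonglongrightarrow> translation_number F"
proof -
  define a where "a n = (F ^^ n) 0" for n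
  have add: "\<bar>a (m + n) - a m - a n\<bar> \<le> 1" for m n
    using degree_one_displacement[OF degree_one_funpow[OF assms], of m "a n"]
    by (simp add: a_def funpow_add)
  have mult: "\<bar>a (m * n) - real m * a n\<bar> \<le> real m" for m n
  proof (induction m)
    case (Suc m)
    then show ?case using add[of n "m * n"] by (simp add: algebra_simps)
  qed (simp add: a_def)
  \<comment> \<open>Both quotients are compared with \<open>a (m * n)\<close>, which is close to
    \<open>m * a n\<close> as well as to \<open>n * a m\<close>.\<close>
  have quot: "\<bar>a m / real m - a n / real n\<bar> \<le> 1 / real m + 1 / real n"
    if "m > 0" "n > 0" for m n
  proof -
    have "\<bar>real n * a m - real m * a n\<bar> \<le> real m + real n"
      using mult[of m n] mult[of n m] by (simp add: mult.commute)
    moreover have "a m / real m - a n / real n = (real n * a m - real m * a n) / (real m * real n)"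
      "1 / real m + 1 / real n = (real m + real n) / (real m * real n)"
      using that by (simp_all add: field_simps)
    ultimately show ?thesis
      by (simp only: abs_divide) (simp add: abs_mult divide_right_mono)
  qed
  have "Cauchy (\<lambda>n. a n / real n)"
  proof (rule metric_CauchyI)
    fix e :: real assume "e > 0"
    then obtain N where N: "N > 0" "1 / real N < e / 2"
      by (metis half_gt_zero nat_approx_posE zero_less_Suc)
    have "dist (a m / real m) (a n / real n) < e" if "m \<ge> N" "n \<ge> N" for m n
    proof -
      have "1 / real m \<le> 1 / real N" "1 / real n \<le> 1 / real N"
        using that N by (auto intro!: divide_left_mono)
      then show ?thesis using quot[of m n] that N by (simp add: dist_real_def)
    qed
    then show "\<exists>M. \<forall>m\<ge>M. \<forall>n\<ge>M. dist (a m / real m) (a n / real n) < e" by blast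
  qed
  then show ?thesis
    unfolding translation_number_def a_def by (simp add: Cauchy_convergent_iff convergent_LIMSEQ_iff)
qed

text \<open>Pushing \<open>h\<close> through \<open>n\<close> iterates produces the integer
  \<open>n * m\<close>, and the orbits involved stay at bounded distance. The lemma serves three
  purposes: \<open>h = id\<close> gives the effect of an integer translation, \<open>h\<close> a
  lift gives conjugation invariance, and a general \<open>h\<close> gives semi-conjugacy
  invariance.\<close>

lemma translation_number_semi_conj:
  assumes F: "degree_one F" and F': "degree_one F'" and h: "degree_one h"
    and eq: "\<And>t. F (h t) = h (F' t) + of_int m"
  shows "translation_number F = translation_number F' + of_int m"
proof -
  have iter: "(F ^^ n) (h 0) = h ((F' ^^ n) 0) + of_int (int n * m)" for n
  proof (induction n)
    case (Suc n)
    then show ?case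
      by (simp only: funpow.simps comp_apply degree_one_of_int[OF F] eq) (simp add: algebra_simps)
  qed simp
  \<comment> \<open>One unit of error comes from \<open>F ^^ n\<close> at \<open>h 0\<close>, the
    other from \<open>h\<close> at \<open>(F' ^^ n) 0\<close>; the terms \<open>h 0\<close>
    cancel.\<close>
  have bound: "\<bar>(F ^^ n) 0 - (F' ^^ n) 0 - real n * m\<bar> \<le> 2" for n
    using degree_one_displacement[OF degree_one_funpow[OF F], of n "h 0"]
      degree_one_displacement[OF h, of "(F' ^^ n) 0"] iter[of n] by simp
  have "(\<lambda>n. (F ^^ n) 0 / real n - (F' ^^ n) 0 / real n - m) \<longlonglongrightarrow> 0"
  proof (rule Lim_null_comparison)
    show "\<forall>\<^sub>F n in sequentially.
        norm ((F ^^ n) 0 / real n - (F' ^^ n) 0 / real n - m) \<le> 2 / real n"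
    proof (rule eventually_sequentiallyI[of 1])
      fix n :: nat assume "1 \<le> n"
      then have "(F ^^ n) 0 / real n - (F' ^^ n) 0 / real n - m
          = ((F ^^ n) 0 - (F' ^^ n) 0 - real n * m) / real n"
        by (simp add: field_simps)
      then show "norm ((F ^^ n) 0 / real n - (F' ^^ n) 0 / real n - m) \<le> 2 / real n"
        by (simp only: real_norm_def abs_divide) (use bound[of n] in \<open>simp add: divide_right_mono\<close>)
    qed
  qed (rule lim_const_over_n)
  moreover have "(\<lambda>n. (F ^^ n) 0 / real n - (F' ^^ n) 0 / real n - m)
      \<longlonglongrightarrow> translation_number F - translation_number F' - m"
    by (intro tendsto_intros translation_number_tendsto F F')
  ultimately have "translation_number F - translation_number F' - m = 0"
    using LIMSEQ_unique by blast
  then show ?thesis by simp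
qed

section \<open>Lifts of circle homeomorphisms\<close>

text \<open>A continuous injection of an interval is monotone, and commuting with the shift excludes
  the decreasing case. Conversely, the values at integers are unbounded in both directions, so the
  intermediate value theorem gives surjectivity.\<close>

lemma Homeo_cover_iff:
  "F \<in> carrier Homeo_cover \<longleftrightarrow> continuous_on UNIV F \<and> strict_mono F \<and> F \<circ> shift = shift \<circ> F"
proof (intro iffI conjI)
  assume F: "F \<in> carrier Homeo_cover"
  then obtain g where g: "homeomorphism UNIV UNIV F g" and comm: "F \<circ> shift = shift \<circ> F"
    by (auto simp: Homeo_cover_def homeos_def)
  show "continuous_on UNIV F" "F \<circ> shift = shift \<circ> F"
    using g comm by (auto simp: homeomorphism_def)
  show "strict_mono F"
  proof (rule strict_monoI)
    fix s t :: real assume "s < t"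
    \<comment> \<open>The added 1 puts \<open>t\<close> strictly inside the interval from
      \<open>s\<close> to \<open>s + n\<close>, whose endpoint values differ by
      \<open>n > 0\<close>.\<close>
    define n where "n = \<lfloor>t - s\<rfloor> + 1"
    have n: "t < s + of_int n" "n > 0"
      using \<open>s < t\<close> unfolding n_def by linarith+
    have "inj_on F {s..s + of_int n}"
      using g by (auto simp: homeomorphism_def inj_on_def) metis
    moreover have "continuous_on {s..s + of_int n} F"
      using \<open>continuous_on UNIV F\<close> continuous_on_subset by blast
    ultimately show "F s < F t"
      using continuous_inj_imp_mono[of s t "s + of_int n" F] \<open>s < t\<close> n
        commutes_shift_of_int[OF comm, of s n] by auto
  qed
next
  assume F: "continuous_on UNIV F \<and> strict_mono F \<and> F \<circ> shift = shift \<circ> F"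
  have "y \<in> range F" for y
  proof -
    \<comment> \<open>This integer exceeds the distance from \<open>y\<close> to \<open>F 0\<close>,
      so \<open>y\<close> lies between \<open>F (-n) = F 0 - n\<close> and
      \<open>F n = F 0 + n\<close>.\<close>
    define n where "n = \<bar>\<lceil>y - F 0\<rceil>\<bar> + 1"
    have "F (of_int (- n)) \<le> y" "y \<le> F (of_int n)"
      using commutes_shift_of_int[of F 0 n] commutes_shift_of_int[of F 0 "- n"] F
      unfolding n_def by simp_all linarith+
    moreover have "real_of_int (- n) \<le> of_int n"
      by (simp add: n_def)
    ultimately obtain x where "F x = y"
      using IVT'[of F "of_int (- n)" y "of_int n"] F continuous_on_subset by blast
    then show ?thesis by blast
  qed
  then have "range F = UNIV" by blast
  then have "\<exists>g. homeomorphism UNIV UNIV F g"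
    using F by (intro homeomorphism_into_1d) (auto simp: strict_mono_imp_inj_on)
  then show "F \<in> carrier Homeo_cover"
    using F by (simp add: Homeo_cover_def homeos_def)
qed

lemma Homeo_cover_degree_one: "F \<in> carrier Homeo_cover \<Longrightarrow> degree_one F"
  by (simp add: Homeo_cover_iff degree_one_def strict_mono_mono)

lemma proj_circle_eq_iff: "proj_circle s = proj_circle t \<longleftrightarrow> s - t \<in> \<int>"
  by (rule circle.abs_eq_iff)

lemma proj_circle_of_int: "proj_circle (t + of_int n) = proj_circle t"
  by (simp add: proj_circle_eq_iff)

text \<open>Distinct integers are at distance at least 1 and the line is connected.\<close>

lemma continuous_Ints_constant:
  fixes u :: "real \<Rightarrow> real"
  assumes "continuous_on UNIV u" "\<And>t. u t \<in> \<int>"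
  obtains n :: int where "\<And>t. u t = of_int n"
proof -
  have "u constant_on UNIV"
  proof (rule continuous_discrete_range_constant)
    fix x
    have "1 \<le> norm (u y - u x)" if "u y \<noteq> u x" for y
      using Ints_nonzero_abs_ge1[of "u y - u x"] assms(2) that by simp
    then show "\<exists>e>0. \<forall>y. y \<in> UNIV \<and> u y \<noteq> u x \<longrightarrow> e \<le> norm (u y - u x)"
      by (intro exI[of _ 1]) auto
  qed (use assms in auto)
  then show ?thesis
    using that assms(2) by (metis Ints_cases UNIV_I constant_on_def)
qed

lemma is_lift_degree_one: "is_lift F f \<Longrightarrow> degree_one F"
  by (simp add: is_lift_def Homeo_cover_degree_one)

lemma is_lift_comp:
  assumes "is_lift F f" "is_lift H g"
  shows "is_lift (F \<circ> H) (f \<circ> g)"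
  unfolding is_lift_def
proof
  have "strict_mono (F \<circ> H)"
    using assms by (auto simp: is_lift_def Homeo_cover_iff strict_mono_def)
  moreover have "continuous_on UNIV (F \<circ> H)"
    using assms by (auto simp: is_lift_def Homeo_cover_iff intro: continuous_on_compose2)
  ultimately show "F \<circ> H \<in> carrier Homeo_cover"
    using assms by (auto simp: is_lift_def Homeo_cover_iff fun_eq_iff)
  show "proj_circle \<circ> (F \<circ> H) = f \<circ> g \<circ> proj_circle"
    using assms by (auto simp: is_lift_def fun_eq_iff)
qed

lemma is_lift_id: "is_lift id id"
  by (simp add: is_lift_def Homeo_cover_iff strict_mono_def)

lemma is_lift_translate:
  assumes "is_lift F f"
  shows "is_lift (\<lambda>t. F t + of_int n) f"
  using assms
  by (auto simp: is_lift_def Homeo_cover_iff strict_mono_def fun_eq_iff shift_def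
      proj_circle_of_int intro!: continuous_intros)

text \<open>The difference of two lifts is continuous and integer-valued, hence constant. This is
  the source of the integers in all the cocycles below.\<close>

lemma is_lift_unique:
  assumes "is_lift F f" "is_lift F' f"
  obtains n :: int where "\<And>t. F' t = F t + of_int n"
proof -
  have "proj_circle (F' t) = proj_circle (F t)" for t
    using assms by (auto simp: is_lift_def fun_eq_iff)
  then obtain n :: int where "\<And>t. F' t - F t = of_int n"
    using assms continuous_Ints_constant[of "\<lambda>t. F' t - F t"]
    by (auto simp: is_lift_def Homeo_cover_iff proj_circle_eq_iff continuous_on_diff)
  then show ?thesis
    using that by (metis add.commute diff_add_cancel)
qed

lemma translation_number_translate:
  assumes "degree_one F"
  shows "translation_number (\<lambda>t. F t + of_int n) = translation_number F + of_int n"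
proof (rule translation_number_semi_conj[where h = id])
  show "degree_one (\<lambda>t. F t + of_int n)"
    using assms by (auto simp: degree_one_def mono_def fun_eq_iff shift_def)
qed (use assms degree_one_id in auto)

text \<open>
  A continuous increasing lift has some degree \<open>d \<ge> 1\<close>. If \<open>d \<ge> 2\<close>, the value \<open>F 0 + 1\<close> would
  already be attained strictly between 0 and 1, against the injectivity of \<open>f\<close>.
\<close>

lemma is_lift_exists:
  assumes f: "f \<in> carrier Homeo_plus"
  shows "\<exists>F. is_lift F f"
proof -
  obtain F g where F: "continuous_on UNIV F" "strict_mono F" "proj_circle \<circ> F = f \<circ> proj_circle"
    and g: "homeomorphism UNIV UNIV f g"
    using f by (auto simp: Homeo_plus_def homeos_def)
  have pF: "proj_circle (F t) = f (proj_circle t)" for t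
    using F(3) by (auto simp: fun_eq_iff)
  have inj: "f x = f y \<Longrightarrow> x = y" for x y
    using g by (metis UNIV_I homeomorphism_apply1)
  have "F (t + 1) - F t \<in> \<int>" for t
    using pF[of t] pF[of "t + 1"] proj_circle_of_int[of t 1] by (simp flip: proj_circle_eq_iff)
  moreover have "continuous_on UNIV (\<lambda>t. F (t + 1) - F t)"
    by (intro continuous_intros continuous_on_compose2[OF F(1)]) auto
  ultimately obtain d :: int where d: "\<And>t. F (t + 1) - F t = of_int d"
    using continuous_Ints_constant[of "\<lambda>t. F (t + 1) - F t"] by blast
  have "d > 0"
    using d[of 0] F(2) strict_monoD[of F 0 1] by simp
  moreover have "\<not> d \<ge> 2"
  proof
    assume "d \<ge> 2"
    then have "F 0 + 1 < F 1" using d[of 0] by simp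
    then obtain s where s: "0 \<le> s" "s \<le> 1" "F s = F 0 + 1"
      using IVT'[of F 0 "F 0 + 1" 1] F(1) continuous_on_subset[of UNIV F "{0..1}"] by auto
    then have "f (proj_circle s) = f (proj_circle 0)"
      using proj_circle_of_int[of "F 0" 1] by (simp flip: pF)
    then have "s - 0 \<in> \<int>"
      using inj proj_circle_eq_iff by blast
    then obtain m :: int where "s = of_int m"
      by (auto elim: Ints_cases)
    then have "s = 0 \<or> s = 1"
      using s by auto
    then show False
      using s \<open>F 0 + 1 < F 1\<close> by auto
  qed
  ultimately have "d = 1" by simp
  then have "F \<circ> shift = shift \<circ> F"
    using d by (auto simp: fun_eq_iff shift_def algebra_simps)
  then show ?thesis
    using F by (auto simp: is_lift_def Homeo_cover_iff)
qed

section \<open>Cohomology classes in low degrees\<close>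

lemma tuples_0: "tuples G 0 = {[]}"
  by (auto simp: tuples_def)

lemma tuples_1: "tuples G (Suc 0) = {[a] | a. a \<in> carrier G}"
  by (auto simp: tuples_def length_Suc_conv)

lemma tuples_2: "tuples G 2 = {[a, b] | a b. a \<in> carrier G \<and> b \<in> carrier G}"
  by (auto simp: tuples_def numeral_2_eq_2 length_Suc_conv)

lemma carrier_cochain_group:
  "carrier (cochain_group G M n) = tuples G n \<rightarrow>\<^sub>E carrier M"
  by (simp add: cochain_group_def)

lemma coboundary_int_1:
  assumes "a \<in> carrier G" "b \<in> carrier G"
  shows "coboundary G integer_group trivial_action (Suc 0) c [a, b] = c [b] - c [a \<otimes>\<^bsub>G\<^esub> b] + c [a]"
proof -
  interpret Z: comm_group integer_group
    by (rule abelian_integer_group)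
  show ?thesis
    using assms by (simp add: coboundary_def tuples_def trivial_action_def merge_at_def
        Z.finprod_singleton_swap)
qed

text \<open>Trades 1-cochains, which are extensional functions on one-element lists, for plain
  functions \<open>u\<close> of a group element.\<close>

lemma mem_coboundaries_2:
  assumes "monoid G"
  shows "f \<in> coboundaries G integer_group trivial_action 2 \<longleftrightarrow>
    f \<in> extensional (tuples G 2) \<and>
    (\<exists>u. \<forall>a \<in> carrier G. \<forall>b \<in> carrier G. f [a, b] = u b - u (a \<otimes>\<^bsub>G\<^esub> b) + u a)"
proof
  assume "f \<in> coboundaries G integer_group trivial_action 2"
  then obtain c where "f = coboundary G integer_group trivial_action 1 c"
    by (auto simp: coboundaries_def)
  then show "f \<in> extensional (tuples G 2) \<and>
      (\<exists>u. \<forall>a \<in> carrier G. \<forall>b \<in> carrier G. f [a, b] = u b - u (a \<otimes>\<^bsub>G\<^esub> b) + u a)"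
    by (auto simp: coboundary_int_1 intro!: exI[of _ "\<lambda>a. c [a]"])
      (simp add: coboundary_def numeral_2_eq_2)
next
  assume "f \<in> extensional (tuples G 2) \<and>
      (\<exists>u. \<forall>a \<in> carrier G. \<forall>b \<in> carrier G. f [a, b] = u b - u (a \<otimes>\<^bsub>G\<^esub> b) + u a)"
  then obtain u where f: "f \<in> extensional (tuples G 2)"
    and u: "\<And>a b. a \<in> carrier G \<Longrightarrow> b \<in> carrier G \<Longrightarrow> f [a, b] = u b - u (a \<otimes>\<^bsub>G\<^esub> b) + u a"
    by blast
  define c where "c = (\<lambda>gs \<in> tuples G 1. u (hd gs))"
  have "f = coboundary G integer_group trivial_action 1 c"
  proof (rule extensionalityI[OF f])
    show "coboundary G integer_group trivial_action 1 c \<in> extensional (tuples G 2)"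
      by (simp add: coboundary_def numeral_2_eq_2)
    show "f gs = coboundary G integer_group trivial_action 1 c gs" if "gs \<in> tuples G 2" for gs
      using that u monoid.m_closed[OF assms]
      by (auto simp: tuples_2 coboundary_int_1 c_def tuples_1)
  qed
  moreover have "c \<in> carrier (cochain_group G integer_group 1)"
    by (simp add: carrier_cochain_group c_def)
  ultimately show "f \<in> coboundaries G integer_group trivial_action 2"
    by (simp add: coboundaries_def)
qed

lemma mem_cohomology_class_2:
  assumes "monoid G"
  shows "f \<in> cohomology_class G integer_group trivial_action 2 c \<longleftrightarrow>
    f \<in> extensional (tuples G 2) \<and>
    (\<exists>u. \<forall>a \<in> carrier G. \<forall>b \<in> carrier G. f [a, b] = u b - u (a \<otimes>\<^bsub>G\<^esub> b) + u a + c [a, b])"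
    (is "_ \<longleftrightarrow> ?rhs")
proof
  assume "f \<in> cohomology_class G integer_group trivial_action 2 c"
  then obtain h where "h \<in> coboundaries G integer_group trivial_action 2"
    and f: "f = (\<lambda>gs \<in> tuples G 2. h gs + c gs)"
    by (auto simp: cohomology_class_def r_coset_def cochain_group_def)
  then obtain u where "\<And>a b. a \<in> carrier G \<Longrightarrow> b \<in> carrier G \<Longrightarrow>
      h [a, b] = u b - u (a \<otimes>\<^bsub>G\<^esub> b) + u a"
    by (auto simp: mem_coboundaries_2[OF assms])
  then show ?rhs
    unfolding f by (auto simp: tuples_2 intro!: exI[of _ u])
next
  assume ?rhs
  then obtain u where f: "f \<in> extensional (tuples G 2)"
    and u: "\<And>a b. a \<in> carrier G \<Longrightarrow> b \<in> carrier G \<Longrightarrow>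
      f [a, b] = u b - u (a \<otimes>\<^bsub>G\<^esub> b) + u a + c [a, b]"
    by blast
  define h where "h = (\<lambda>gs \<in> tuples G 2. f gs - c gs)"
  have "h \<in> coboundaries G integer_group trivial_action 2"
    unfolding mem_coboundaries_2[OF assms]
    using u by (auto simp: h_def tuples_2 intro!: exI[of _ u])
  moreover have "f = (\<lambda>gs \<in> tuples G 2. h gs + c gs)"
    by (rule extensionalityI[OF f]) (auto simp: h_def)
  ultimately show "f \<in> cohomology_class G integer_group trivial_action 2 c"
    by (auto simp: cohomology_class_def r_coset_def cochain_group_def)
qed

lemma cohomology_class_2_eqI:
  assumes "monoid G"
    and u: "\<And>a b. a \<in> carrier G \<Longrightarrow> b \<in> carrier G \<Longrightarrow>
      c' [a, b] = u b - u (a \<otimes>\<^bsub>G\<^esub> b) + u a + c [a, b]"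
  shows "cohomology_class G integer_group trivial_action 2 c' =
    cohomology_class G integer_group trivial_action 2 c"
proof (intro equalityI subsetI)
  fix f assume "f \<in> cohomology_class G integer_group trivial_action 2 c'"
  then obtain w where "f \<in> extensional (tuples G 2)" and
    "\<And>a b. a \<in> carrier G \<Longrightarrow> b \<in> carrier G \<Longrightarrow>
      f [a, b] = w b - w (a \<otimes>\<^bsub>G\<^esub> b) + w a + c' [a, b]"
    by (auto simp: mem_cohomology_class_2[OF assms(1)])
  then show "f \<in> cohomology_class G integer_group trivial_action 2 c"
    unfolding mem_cohomology_class_2[OF assms(1)]
    using u by (auto intro!: exI[of _ "\<lambda>a. w a + u a"])
next
  fix f assume "f \<in> cohomology_class G integer_group trivial_action 2 c"
  then obtain w where "f \<in> extensional (tuples G 2)" and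
    "\<And>a b. a \<in> carrier G \<Longrightarrow> b \<in> carrier G \<Longrightarrow>
      f [a, b] = w b - w (a \<otimes>\<^bsub>G\<^esub> b) + w a + c [a, b]"
    by (auto simp: mem_cohomology_class_2[OF assms(1)])
  then show "f \<in> cohomology_class G integer_group trivial_action 2 c'"
    unfolding mem_cohomology_class_2[OF assms(1)]
    using u by (auto intro!: exI[of _ "\<lambda>a. w a - u a"])
qed

lemma mem_own_cohomology_class_2:
  assumes "monoid G" "c \<in> extensional (tuples G 2)"
  shows "c \<in> cohomology_class G integer_group trivial_action 2 c"
  using assms by (auto simp: mem_cohomology_class_2 intro!: exI[of _ "\<lambda>_. 0"])

text \<open>Changing the representative by the coboundary of \<open>u\<close> changes the pulled
  back cochain by the coboundary of \<open>u \<circ> \<phi>\<close>. Hence the description in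
  \<open>pullback\<close> is definite and any representative may be used.\<close>

lemma pullback_cohomology_class_2:
  assumes H: "monoid H" and G: "monoid G" and \<phi>: "\<phi> \<in> hom H G"
    and c: "c \<in> extensional (tuples G 2)"
  shows "pullback H integer_group 2 \<phi> (cohomology_class G integer_group trivial_action 2 c) =
    cohomology_class H integer_group trivial_action 2 (\<lambda>hs \<in> tuples H 2. c (map \<phi> hs))"
  unfolding pullback_def
proof (rule the_equality)
  show "\<exists>c' \<in> cohomology_class G integer_group trivial_action 2 c.
      cohomology_class H integer_group trivial_action 2 (\<lambda>hs \<in> tuples H 2. c (map \<phi> hs)) =
      cohomology_class H integer_group trivial_action 2 (\<lambda>hs \<in> tuples H 2. c' (map \<phi> hs))"
    using mem_own_cohomology_class_2[OF G c] by blast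
next
  fix D assume "\<exists>c' \<in> cohomology_class G integer_group trivial_action 2 c.
      D = cohomology_class H integer_group trivial_action 2 (\<lambda>hs \<in> tuples H 2. c' (map \<phi> hs))"
  then obtain c' u
    where D: "D = cohomology_class H integer_group trivial_action 2 (\<lambda>hs \<in> tuples H 2. c' (map \<phi> hs))"
      and u: "\<And>a b. a \<in> carrier G \<Longrightarrow> b \<in> carrier G \<Longrightarrow>
        c' [a, b] = u b - u (a \<otimes>\<^bsub>G\<^esub> b) + u a + c [a, b]"
    by (auto simp: mem_cohomology_class_2[OF G])
  show "D = cohomology_class H integer_group trivial_action 2 (\<lambda>hs \<in> tuples H 2. c (map \<phi> hs))"
    unfolding D
    by (rule cohomology_class_2_eqI[OF H, where u = "u \<circ> \<phi>"])
      (use u \<phi> in \<open>auto simp: tuples_2 hom_mult hom_in_carrier\<close>)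
qed

text \<open>The neutral element of the quotient group is the set of coboundaries itself, and the
  pulled back cochain belongs to its own class. The function \<open>u\<close> later corrects the
  lifts on \<open>K\<close>.\<close>

lemma Ker_res_imp_coboundary:
  assumes K: "monoid K" and \<Gamma>: "monoid \<Gamma>" and i: "i \<in> hom K \<Gamma>"
    and c: "c \<in> extensional (tuples \<Gamma> 2)"
    and ker: "cohomology_class \<Gamma> integer_group trivial_action 2 c \<in> Ker_res K \<Gamma> i"
  obtains u where "\<And>x y. x \<in> carrier K \<Longrightarrow> y \<in> carrier K \<Longrightarrow>
    c [i x, i y] = u y - u (x \<otimes>\<^bsub>K\<^esub> y) + u x"
proof -
  have "cohomology_class K integer_group trivial_action 2 (\<lambda>hs \<in> tuples K 2. c (map i hs)) =
      coboundaries K integer_group trivial_action 2"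
    using ker pullback_cohomology_class_2[OF K \<Gamma> i c]
    by (simp add: Ker_res_def kernel_def cohomology_def)
  then have "(\<lambda>hs \<in> tuples K 2. c (map i hs)) \<in> coboundaries K integer_group trivial_action 2"
    using mem_own_cohomology_class_2[OF K, of "\<lambda>hs \<in> tuples K 2. c (map i hs)"] by simp
  then show ?thesis
    using that by (auto simp: mem_coboundaries_2[OF K] tuples_2)
qed

section \<open>Degree-one classes with coefficients in Hom(K,Z)\<close>

lemma carrier_H1_int: "carrier (H1_int K) = hom K integer_group \<inter> extensional (carrier K)"
  by (simp add: H1_int_def)

lemma mult_H1_int: "v \<otimes>\<^bsub>H1_int K\<^esub> w = (\<lambda>x \<in> carrier K. v x + w x)"
  by (simp add: H1_int_def product_group_def)

lemma one_H1_int: "\<one>\<^bsub>H1_int K\<^esub> = (\<lambda>x \<in> carrier K. 0)"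
  by (simp add: H1_int_def product_group_def)

lemma restrict_in_H1_int:
  assumes "group K" "\<And>x y. x \<in> carrier K \<Longrightarrow> y \<in> carrier K \<Longrightarrow> v (x \<otimes>\<^bsub>K\<^esub> y) = v x + v y"
  shows "(\<lambda>x \<in> carrier K. v x) \<in> carrier (H1_int K)"
  using assms by (auto simp: carrier_H1_int hom_def group.is_monoid monoid.m_closed)

text \<open>The group structure is needed to evaluate the power with exponent -1 in
  \<open>coboundary\<close>.\<close>

lemma group_H1_int:
  assumes K: "group K"
  shows "group (H1_int K)"
proof (rule groupI)
  fix v assume v: "v \<in> carrier (H1_int K)"
  then have "(\<lambda>x \<in> carrier K. - v x) \<in> carrier (H1_int K)"
    by (intro restrict_in_H1_int[OF K]) (auto simp: carrier_H1_int hom_mult)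
  then show "\<exists>w \<in> carrier (H1_int K). w \<otimes>\<^bsub>H1_int K\<^esub> v = \<one>\<^bsub>H1_int K\<^esub>"
    by (auto simp: mult_H1_int one_H1_int intro!: bexI)
qed (use K in \<open>auto simp: mult_H1_int one_H1_int carrier_H1_int hom_mult
    group.is_monoid monoid.m_closed extensional_def fun_eq_iff
    intro!: restrict_in_H1_int[unfolded carrier_H1_int, THEN IntD1]\<close>)

lemma inv_H1_int:
  assumes K: "group K" and v: "v \<in> carrier (H1_int K)"
  shows "inv\<^bsub>H1_int K\<^esub> v = (\<lambda>x \<in> carrier K. - v x)"
proof (rule group.inv_equality[OF group_H1_int[OF K] _ v])
  show "(\<lambda>x \<in> carrier K. - v x) \<in> carrier (H1_int K)"
    using v by (intro restrict_in_H1_int[OF K]) (auto simp: carrier_H1_int hom_mult)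
qed (auto simp: mult_H1_int one_H1_int)

lemma coboundary_H1_int_0:
  assumes K: "group K" and v: "c [] \<in> carrier (H1_int K)" and "g \<in> carrier G"
  shows "coboundary G (H1_int K) a 0 c [g] = (\<lambda>x \<in> carrier K. a g (c []) x - c [] x)"
proof -
  have "c [] [^]\<^bsub>H1_int K\<^esub> (- 1 :: int) = (\<lambda>x \<in> carrier K. - c [] x)"
    using group.int_pow_neg[OF group_H1_int[OF K] v, of 1] group.int_pow_1[OF group_H1_int[OF K] v]
      inv_H1_int[OF K v] by simp
  \<comment> \<open>The product over the empty range \<open>{1..0}\<close> evaluates to the zero
    homomorphism once this is known to lie in the carrier.\<close>
  moreover have "(\<lambda>x \<in> carrier K. 0) \<in> carrier (H1_int K)"
    by (rule restrict_in_H1_int[OF K]) simp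
  ultimately show ?thesis
    using assms(3) by (auto simp: coboundary_def tuples_1 mult_H1_int one_H1_int finprod_def
        fun_eq_iff)
qed

text \<open>A 0-cochain is a single element \<open>v\<close>, its value at the empty list; its
  coboundary is the principal crossed homomorphism sending \<open>g\<close> to
  \<open>a g v - v\<close>.\<close>

lemma mem_crossed_hom_class_H1_int:
  assumes K: "group K"
  shows "f \<in> crossed_hom_class G (H1_int K) a k \<longleftrightarrow>
    f \<in> extensional (tuples G 1) \<and>
    (\<exists>v \<in> carrier (H1_int K). \<forall>g \<in> carrier G. f [g] = (\<lambda>x \<in> carrier K. a g v x - v x + k g x))"
    (is "_ \<longleftrightarrow> ?rhs")
proof
  assume "f \<in> crossed_hom_class G (H1_int K) a k"
  then obtain c where c: "c \<in> carrier (cochain_group G (H1_int K) 0)"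
    and f: "f = (\<lambda>gs \<in> tuples G 1. coboundary G (H1_int K) a 0 c gs
        \<otimes>\<^bsub>H1_int K\<^esub> (\<lambda>gs \<in> tuples G 1. k (hd gs)) gs)"
    by (auto simp: crossed_hom_class_def cohomology_class_def coboundaries_def r_coset_def
        cochain_group_def)
  then have v: "c [] \<in> carrier (H1_int K)"
    by (auto simp: carrier_cochain_group tuples_0)
  show ?rhs
    unfolding f
    by (intro conjI bexI[OF _ v])
      (auto simp: tuples_1 mult_H1_int coboundary_H1_int_0[where c = c, OF K v] fun_eq_iff)
next
  assume ?rhs
  then obtain v where f: "f \<in> extensional (tuples G 1)" and v: "v \<in> carrier (H1_int K)"
    and eq: "\<And>g. g \<in> carrier G \<Longrightarrow> f [g] = (\<lambda>x \<in> carrier K. a g v x - v x + k g x)"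
    by blast
  define c where "c = (\<lambda>gs \<in> tuples G 0. v)"
  have c: "c \<in> carrier (cochain_group G (H1_int K) 0)" "c [] = v"
    using v by (auto simp: c_def carrier_cochain_group tuples_0)
  have cob: "coboundary G (H1_int K) a 0 c [g] = (\<lambda>x \<in> carrier K. a g v x - v x)"
    if "g \<in> carrier G" for g
    using coboundary_H1_int_0[where c = c, OF K _ that] c v by simp
  have "f = (\<lambda>gs \<in> tuples G 1. coboundary G (H1_int K) a 0 c gs
      \<otimes>\<^bsub>H1_int K\<^esub> (\<lambda>gs \<in> tuples G 1. k (hd gs)) gs)"
    by (rule extensionalityI[OF f])
      (use eq cob in \<open>auto simp: tuples_1 mult_H1_int fun_eq_iff\<close>)
  then show "f \<in> crossed_hom_class G (H1_int K) a k"
    using c(1) by (auto simp: crossed_hom_class_def cohomology_class_def coboundaries_def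
        r_coset_def cochain_group_def)
qed

section \<open>The Euler class and sections of the universal covering\<close>

lemma monoid_Homeo_plus: "monoid Homeo_plus"
proof (rule monoidI)
  fix f g assume f: "f \<in> carrier Homeo_plus" and g: "g \<in> carrier Homeo_plus"
  obtain f' g' where "homeomorphism UNIV UNIV f f'" "homeomorphism UNIV UNIV g g'"
    using f g by (auto simp: Homeo_plus_def homeos_def)
  then have "f \<circ> g \<in> homeos"
    unfolding homeos_def using homeomorphism_compose by blast
  moreover obtain E where "is_lift E (f \<circ> g)"
    using is_lift_exists[OF f] is_lift_exists[OF g] is_lift_comp by blast
  ultimately show "f \<otimes>\<^bsub>Homeo_plus\<^esub> g \<in> carrier Homeo_plus"
    by (auto simp: Homeo_plus_def is_lift_def Homeo_cover_iff)
next
  have "homeomorphism UNIV UNIV (id :: circle \<Rightarrow> circle) id"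
    by (auto simp: homeomorphism_def)
  then show "\<one>\<^bsub>Homeo_plus\<^esub> \<in> carrier Homeo_plus"
    using is_lift_id by (auto simp: Homeo_plus_def homeos_def is_lift_def Homeo_cover_iff intro!: exI[of _ id])
qed (auto simp: Homeo_plus_def)

lemma is_lift_some_lift: "f \<in> carrier Homeo_plus \<Longrightarrow> is_lift (some_lift f) f"
  unfolding some_lift_def using is_lift_exists by (rule someI_ex)

text \<open>
  The lifts with translation number in \<open>[0, 1)\<close> form a section of the universal covering whose
  failure to be multiplicative is the Euler cocycle.
\<close>

definition reduced_lift :: "(circle \<Rightarrow> circle) \<Rightarrow> real \<Rightarrow> real" where
  "reduced_lift f t = some_lift f t + of_int (- \<lfloor>translation_number (some_lift f)\<rfloor>)"

lemma is_lift_reduced_lift: "f \<in> carrier Homeo_plus \<Longrightarrow> is_lift (reduced_lift f) f"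
  using is_lift_translate[OF is_lift_some_lift]
  by (simp add: reduced_lift_def[abs_def] del: of_int_minus)

lemma translation_number_reduced_lift:
  assumes "f \<in> carrier Homeo_plus"
  shows "\<lfloor>translation_number (reduced_lift f)\<rfloor> = 0"
  using translation_number_translate[OF is_lift_degree_one[OF is_lift_some_lift[OF assms]]]
  by (simp add: reduced_lift_def[abs_def] del: of_int_minus)

text \<open>The two sides lift the same map, so they differ by some integer \<open>c\<close>.
  Computing the translation number of the composite in two ways and taking floors identifies
  \<open>c\<close>, since the reduced lift of \<open>f \<circ> g\<close> contributes floor
  0.\<close>

lemma reduced_lift_mult:
  assumes f: "f \<in> carrier Homeo_plus" and g: "g \<in> carrier Homeo_plus"
  shows "reduced_lift f (reduced_lift g t) = reduced_lift (f \<circ> g) t + of_int (euler_cocycle [f, g])"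
proof -
  have fg: "f \<circ> g \<in> carrier Homeo_plus"
    using monoid.m_closed[OF monoid_Homeo_plus f g] by (simp add: Homeo_plus_def)
  let ?F = "some_lift f" and ?H = "some_lift g"
  let ?m = "\<lfloor>translation_number ?F\<rfloor>" and ?n = "\<lfloor>translation_number ?H\<rfloor>"
  have deg: "degree_one ?F" "degree_one ?H" "degree_one (reduced_lift (f \<circ> g))"
    using f g fg is_lift_degree_one is_lift_some_lift is_lift_reduced_lift by blast+
  have comp: "(reduced_lift f \<circ> reduced_lift g) t = (?F \<circ> ?H) t + of_int (- ?m - ?n)" for t
    using degree_one_of_int[OF deg(1), of "?H t" "- ?n"] by (simp add: reduced_lift_def)
  obtain c :: int
    where c: "\<And>t. (reduced_lift f \<circ> reduced_lift g) t = reduced_lift (f \<circ> g) t + of_int c"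
    using is_lift_unique[OF is_lift_reduced_lift[OF fg]
        is_lift_comp[OF is_lift_reduced_lift[OF f] is_lift_reduced_lift[OF g]]] by blast
  have "reduced_lift f \<circ> reduced_lift g = (\<lambda>t. (?F \<circ> ?H) t + of_int (- ?m - ?n))"
    "reduced_lift f \<circ> reduced_lift g = (\<lambda>t. reduced_lift (f \<circ> g) t + of_int c)"
    using comp c by blast+
  then have "translation_number (?F \<circ> ?H) + of_int (- ?m - ?n) =
      translation_number (reduced_lift (f \<circ> g)) + of_int c"
    using translation_number_translate[OF degree_one_comp[OF deg(1,2)]]
      translation_number_translate[OF deg(3)] by metis
  then have "\<lfloor>translation_number (?F \<circ> ?H) + of_int (- ?m - ?n)\<rfloor> =
      \<lfloor>translation_number (reduced_lift (f \<circ> g)) + of_int c\<rfloor>"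
    by simp
  then have "\<lfloor>translation_number (?F \<circ> ?H)\<rfloor> - ?m - ?n = c"
    using translation_number_reduced_lift[OF fg]
    by (simp only: floor_add_int[symmetric])
  then have "euler_cocycle [f, g] = c"
    using f g by (simp add: euler_cocycle_def tuples_def Let_def)
  then show ?thesis
    using c[of t] by simp
qed

lemma euler_class_of_eq:
  assumes "monoid \<Gamma>" "\<rho> \<in> hom \<Gamma> Homeo_plus"
  shows "euler_class_of \<Gamma> \<rho> = cohomology_class \<Gamma> integer_group trivial_action 2
    (\<lambda>gs \<in> tuples \<Gamma> 2. euler_cocycle (map \<rho> gs))"
  unfolding euler_class_of_def euler_class_def
  by (rule pullback_cohomology_class_2[OF assms(1) monoid_Homeo_plus assms(2)])
    (simp add: euler_cocycle_def)

lemma Homeo_plus_hom_comp: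
  "\<rho> \<in> hom \<Gamma> Homeo_plus \<Longrightarrow> a \<in> carrier \<Gamma> \<Longrightarrow> b \<in> carrier \<Gamma> \<Longrightarrow> \<rho> (a \<otimes>\<^bsub>\<Gamma>\<^esub> b) = \<rho> a \<circ> \<rho> b"
  by (simp add: hom_def Homeo_plus_def)

text \<open>A choice of lifts differs from the reduced lifts by an integer function
  \<open>u\<close>; the two cocycles then differ by the coboundary of \<open>u\<close>, because
  integer translations are central.\<close>

lemma section_cocycle_in_euler_class:
  assumes \<Gamma>: "monoid \<Gamma>" and \<rho>: "\<rho> \<in> hom \<Gamma> Homeo_plus"
    and \<sigma>: "\<And>\<gamma>. \<gamma> \<in> carrier \<Gamma> \<Longrightarrow> is_lift (\<sigma> \<gamma>) (\<rho> \<gamma>)"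
    and f: "f \<in> extensional (tuples \<Gamma> 2)"
    and eq: "\<And>a b t. a \<in> carrier \<Gamma> \<Longrightarrow> b \<in> carrier \<Gamma> \<Longrightarrow>
      \<sigma> a (\<sigma> b t) = \<sigma> (a \<otimes>\<^bsub>\<Gamma>\<^esub> b) t + of_int (f [a, b])"
  shows "f \<in> euler_class_of \<Gamma> \<rho>"
proof -
  have in_Homeo: "\<rho> \<gamma> \<in> carrier Homeo_plus" if "\<gamma> \<in> carrier \<Gamma>" for \<gamma>
    using hom_in_carrier[OF \<rho> that] .
  have "\<exists>n :: int. \<forall>t. \<sigma> \<gamma> t = reduced_lift (\<rho> \<gamma>) t + of_int n" if "\<gamma> \<in> carrier \<Gamma>" for \<gamma>
    using is_lift_unique[OF is_lift_reduced_lift[OF in_Homeo[OF that]] \<sigma>[OF that]] by metis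
  then obtain u :: "_ \<Rightarrow> int"
    where u: "\<And>\<gamma> t. \<gamma> \<in> carrier \<Gamma> \<Longrightarrow> \<sigma> \<gamma> t = reduced_lift (\<rho> \<gamma>) t + of_int (u \<gamma>)"
    by metis
  have "f [a, b] = u b - u (a \<otimes>\<^bsub>\<Gamma>\<^esub> b) + u a + euler_cocycle [\<rho> a, \<rho> b]"
    if ab: "a \<in> carrier \<Gamma>" "b \<in> carrier \<Gamma>" for a b
  proof -
    note Ra = in_Homeo[OF ab(1)] and Rb = in_Homeo[OF ab(2)]
    have "a \<otimes>\<^bsub>\<Gamma>\<^esub> b \<in> carrier \<Gamma>"
      using monoid.m_closed[OF \<Gamma>] ab by blast
    then have "\<sigma> a (\<sigma> b 0) = reduced_lift (\<rho> a \<circ> \<rho> b) 0 + u (a \<otimes>\<^bsub>\<Gamma>\<^esub> b) + f [a, b]"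
      using eq[OF ab] u Homeo_plus_hom_comp[OF \<rho> ab] by simp
    moreover have "\<sigma> a (\<sigma> b 0) =
        reduced_lift (\<rho> a \<circ> \<rho> b) 0 + euler_cocycle [\<rho> a, \<rho> b] + u a + u b"
      using ab u degree_one_of_int[OF is_lift_degree_one[OF is_lift_reduced_lift[OF Ra]]]
        reduced_lift_mult[OF Ra Rb, of 0] by simp
    ultimately have "real_of_int (f [a, b]) =
        of_int (u b - u (a \<otimes>\<^bsub>\<Gamma>\<^esub> b) + u a + euler_cocycle [\<rho> a, \<rho> b])"
      by simp
    then show ?thesis by (simp only: of_int_eq_iff)
  qed
  then show ?thesis
    unfolding euler_class_of_eq[OF \<Gamma> \<rho>] mem_cohomology_class_2[OF \<Gamma>]
    using f by (auto simp: tuples_2 intro!: exI[of _ u])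
qed

text \<open>On \<open>K\<close> the Euler cocycle is the coboundary of some \<open>u\<close>;
  translating the reduced lift of each \<open>x\<close> by \<open>- u x\<close> cancels the failure
  of multiplicativity.\<close>

lemma lifts_hom_exists:
  assumes K: "monoid K" and \<Gamma>: "monoid \<Gamma>" and i: "i \<in> hom K \<Gamma>" and \<rho>: "\<rho> \<in> hom \<Gamma> Homeo_plus"
    and ker: "euler_class_of \<Gamma> \<rho> \<in> Ker_res K \<Gamma> i"
  shows "\<exists>\<rho>'. lifts_hom K (\<rho> \<circ> i) \<rho>'"
proof -
  have comp: "\<rho> \<circ> i \<in> hom K Homeo_plus"
    using i \<rho> by (rule hom_compose)
  obtain u where u: "\<And>x y. x \<in> carrier K \<Longrightarrow> y \<in> carrier K \<Longrightarrow>
      (\<lambda>gs \<in> tuples \<Gamma> 2. euler_cocycle (map \<rho> gs)) [i x, i y] = u y - u (x \<otimes>\<^bsub>K\<^esub> y) + u x"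
    using Ker_res_imp_coboundary[OF K \<Gamma> i _ ker[unfolded euler_class_of_eq[OF \<Gamma> \<rho>]]] by auto
  define \<rho>' where "\<rho>' x t = reduced_lift (\<rho> (i x)) t + of_int (- u x)" for x t
  have in_Homeo: "\<rho> (i x) \<in> carrier Homeo_plus" if "x \<in> carrier K" for x
    using hom_in_carrier[OF comp that] by simp
  have lift: "is_lift (\<rho>' x) (\<rho> (i x))" if "x \<in> carrier K" for x
    using is_lift_translate[OF is_lift_reduced_lift[OF in_Homeo[OF that]]]
    by (simp add: \<rho>'_def[abs_def] del: of_int_minus)
  have "\<rho>' (x \<otimes>\<^bsub>K\<^esub> y) = \<rho>' x \<circ> \<rho>' y" if xy: "x \<in> carrier K" "y \<in> carrier K" for x y
  proof
    fix t
    note Rx = in_Homeo[OF xy(1)] and Ry = in_Homeo[OF xy(2)]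
    have "euler_cocycle [\<rho> (i x), \<rho> (i y)] = u y - u (x \<otimes>\<^bsub>K\<^esub> y) + u x"
      using u[OF xy] hom_in_carrier[OF i] xy by (simp add: tuples_def)
    then show "\<rho>' (x \<otimes>\<^bsub>K\<^esub> y) t = (\<rho>' x \<circ> \<rho>' y) t"
      using degree_one_of_int[OF is_lift_degree_one[OF is_lift_reduced_lift[OF Rx]], of _ "- u y"]
        reduced_lift_mult[OF Rx Ry, of t] Homeo_plus_hom_comp[OF comp xy]
      by (simp add: \<rho>'_def)
  qed
  then have "lifts_hom K (\<rho> \<circ> i) \<rho>'"
    using lift by (auto simp: lifts_hom_def hom_def is_lift_def Homeo_cover_def)
  then show ?thesis by blast
qed

section \<open>Crossed homomorphisms of an extension\<close>

context group_extension
begin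

sublocale K: group K by (rule group_K)
sublocale \<Gamma>: group \<Gamma> by (rule group_\<Gamma>)
sublocale G: group G by (rule group_G)

lemma i_hom: "i \<in> hom K \<Gamma>" and i_inj: "inj_on i (carrier K)"
  using i_mon by (auto simp: mon_def)

lemma p_hom: "p \<in> hom \<Gamma> G" and p_surj: "p ` carrier \<Gamma> = carrier G"
  using p_epi by (auto simp: epi_def)

lemma i_closed: "x \<in> carrier K \<Longrightarrow> i x \<in> carrier \<Gamma>"
  using hom_in_carrier[OF i_hom] .

lemma p_closed: "\<gamma> \<in> carrier \<Gamma> \<Longrightarrow> p \<gamma> \<in> carrier G"
  using hom_in_carrier[OF p_hom] .

lemma p_mult: "a \<in> carrier \<Gamma> \<Longrightarrow> b \<in> carrier \<Gamma> \<Longrightarrow> p (a \<otimes>\<^bsub>\<Gamma>\<^esub> b) = p a \<otimes>\<^bsub>G\<^esub> p b"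
  using hom_mult[OF p_hom] .

lemma i_mult: "x \<in> carrier K \<Longrightarrow> y \<in> carrier K \<Longrightarrow> i (x \<otimes>\<^bsub>K\<^esub> y) = i x \<otimes>\<^bsub>\<Gamma>\<^esub> i y"
  using hom_mult[OF i_hom] .

lemma p_one: "p \<one>\<^bsub>\<Gamma>\<^esub> = \<one>\<^bsub>G\<^esub>"
  using hom_one[OF p_hom group_\<Gamma> group_G] .

lemma i_one: "i \<one>\<^bsub>K\<^esub> = \<one>\<^bsub>\<Gamma>\<^esub>"
  using hom_one[OF i_hom group_K group_\<Gamma>] .

lemma p_inv: "a \<in> carrier \<Gamma> \<Longrightarrow> p (inv\<^bsub>\<Gamma>\<^esub> a) = inv\<^bsub>G\<^esub> (p a)"
  using group_hom.hom_inv[of \<Gamma> G p] p_hom group_\<Gamma> group_G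
  by (simp add: group_hom_def group_hom_axioms_def)

lemma p_i: "x \<in> carrier K \<Longrightarrow> p (i x) = \<one>\<^bsub>G\<^esub>"
  using exact by (auto simp: kernel_def)

lemma p_mult_i: "\<gamma> \<in> carrier \<Gamma> \<Longrightarrow> x \<in> carrier K \<Longrightarrow> p (\<gamma> \<otimes>\<^bsub>\<Gamma>\<^esub> i x) = p \<gamma>"
  by (simp add: p_mult i_closed p_i p_closed)

lemma same_p:
  assumes "\<gamma> \<in> carrier \<Gamma>" "\<gamma>' \<in> carrier \<Gamma>" "p \<gamma> = p \<gamma>'"
  obtains y where "y \<in> carrier K" "\<gamma>' = \<gamma> \<otimes>\<^bsub>\<Gamma>\<^esub> i y"
proof -
  have "inv\<^bsub>\<Gamma>\<^esub> \<gamma> \<otimes>\<^bsub>\<Gamma>\<^esub> \<gamma>' \<in> kernel \<Gamma> G p"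
    using assms by (simp add: kernel_def p_mult p_inv p_closed)
  then obtain y where "y \<in> carrier K" "i y = inv\<^bsub>\<Gamma>\<^esub> \<gamma> \<otimes>\<^bsub>\<Gamma>\<^esub> \<gamma>'"
    using exact by (metis imageE)
  moreover from this have "\<gamma>' = \<gamma> \<otimes>\<^bsub>\<Gamma>\<^esub> i y"
    using assms by (simp add: \<Gamma>.m_assoc[symmetric])
  ultimately show ?thesis using that by blast
qed

lemma p_lift:
  assumes "g \<in> carrier G"
  shows "inv_into (carrier \<Gamma>) p g \<in> carrier \<Gamma>" "p (inv_into (carrier \<Gamma>) p g) = g"
  using assms p_surj by (metis inv_into_into, metis f_inv_into_f)

section \<open>Conjugation of K by elements of \<Gamma>\<close>

lemma
  assumes "\<gamma> \<in> carrier \<Gamma>" "x \<in> carrier K"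
  shows conj_by_closed: "conj_by K \<Gamma> i \<gamma> x \<in> carrier K"
    and i_conj_by: "i (conj_by K \<Gamma> i \<gamma> x) = inv\<^bsub>\<Gamma>\<^esub> \<gamma> \<otimes>\<^bsub>\<Gamma>\<^esub> i x \<otimes>\<^bsub>\<Gamma>\<^esub> \<gamma>"
proof -
  have "inv\<^bsub>\<Gamma>\<^esub> \<gamma> \<otimes>\<^bsub>\<Gamma>\<^esub> i x \<otimes>\<^bsub>\<Gamma>\<^esub> \<gamma> \<in> kernel \<Gamma> G p"
    using assms by (simp add: kernel_def p_mult p_inv p_closed p_i i_closed)
  then have "inv\<^bsub>\<Gamma>\<^esub> \<gamma> \<otimes>\<^bsub>\<Gamma>\<^esub> i x \<otimes>\<^bsub>\<Gamma>\<^esub> \<gamma> \<in> i ` carrier K"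
    by (simp add: exact)
  then show "conj_by K \<Gamma> i \<gamma> x \<in> carrier K"
    "i (conj_by K \<Gamma> i \<gamma> x) = inv\<^bsub>\<Gamma>\<^esub> \<gamma> \<otimes>\<^bsub>\<Gamma>\<^esub> i x \<otimes>\<^bsub>\<Gamma>\<^esub> \<gamma>"
    unfolding conj_by_def by (rule inv_into_into, rule f_inv_into_f)
qed

lemma i_mult_conj_by:
  assumes "\<gamma> \<in> carrier \<Gamma>" "x \<in> carrier K"
  shows "i x \<otimes>\<^bsub>\<Gamma>\<^esub> \<gamma> = \<gamma> \<otimes>\<^bsub>\<Gamma>\<^esub> i (conj_by K \<Gamma> i \<gamma> x)"
  using assms by (simp add: i_conj_by i_closed \<Gamma>.m_assoc[symmetric])

text \<open>Cancellation of \<open>\<gamma>\<close> and injectivity of \<open>i\<close> turn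
  identities for \<open>conj_by\<close> into the task of moving \<open>\<gamma>\<close> past
  elements of \<open>i K\<close>, with no inverses involved.\<close>

lemma conj_by_eqI:
  assumes "\<gamma> \<in> carrier \<Gamma>" "x \<in> carrier K" "z \<in> carrier K" "i x \<otimes>\<^bsub>\<Gamma>\<^esub> \<gamma> = \<gamma> \<otimes>\<^bsub>\<Gamma>\<^esub> i z"
  shows "conj_by K \<Gamma> i \<gamma> x = z"
proof -
  have "\<gamma> \<otimes>\<^bsub>\<Gamma>\<^esub> i (conj_by K \<Gamma> i \<gamma> x) = \<gamma> \<otimes>\<^bsub>\<Gamma>\<^esub> i z"
    using i_mult_conj_by[OF assms(1,2)] assms(4) by simp
  then have "i (conj_by K \<Gamma> i \<gamma> x) = i z"
    using assms by (simp add: i_closed conj_by_closed)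
  then show ?thesis
    using assms conj_by_closed i_inj by (auto dest: inj_onD)
qed

lemma conj_by_mult:
  assumes "\<gamma> \<in> carrier \<Gamma>" "x \<in> carrier K" "y \<in> carrier K"
  shows "conj_by K \<Gamma> i \<gamma> (x \<otimes>\<^bsub>K\<^esub> y) = conj_by K \<Gamma> i \<gamma> x \<otimes>\<^bsub>K\<^esub> conj_by K \<Gamma> i \<gamma> y"
proof (rule conj_by_eqI)
  have "i (x \<otimes>\<^bsub>K\<^esub> y) \<otimes>\<^bsub>\<Gamma>\<^esub> \<gamma> = i x \<otimes>\<^bsub>\<Gamma>\<^esub> (\<gamma> \<otimes>\<^bsub>\<Gamma>\<^esub> i (conj_by K \<Gamma> i \<gamma> y))"
    using assms by (simp add: i_mult i_closed \<Gamma>.m_assoc i_mult_conj_by[of \<gamma> y])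
  also have "\<dots> = \<gamma> \<otimes>\<^bsub>\<Gamma>\<^esub> i (conj_by K \<Gamma> i \<gamma> x) \<otimes>\<^bsub>\<Gamma>\<^esub> i (conj_by K \<Gamma> i \<gamma> y)"
    using assms by (simp add: i_closed conj_by_closed i_mult_conj_by[of \<gamma> x] flip: \<Gamma>.m_assoc)
  finally show "i (x \<otimes>\<^bsub>K\<^esub> y) \<otimes>\<^bsub>\<Gamma>\<^esub> \<gamma> =
      \<gamma> \<otimes>\<^bsub>\<Gamma>\<^esub> i (conj_by K \<Gamma> i \<gamma> x \<otimes>\<^bsub>K\<^esub> conj_by K \<Gamma> i \<gamma> y)"
    using assms by (simp add: i_mult i_closed \<Gamma>.m_assoc conj_by_closed)
qed (use assms conj_by_closed in auto)

text \<open>The order is reversed: \<open>conj_by\<close> acts on \<open>K\<close> from the right,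
  which makes the induced action on homomorphisms a left action.\<close>

lemma conj_by_comp:
  assumes "\<gamma> \<in> carrier \<Gamma>" "\<delta> \<in> carrier \<Gamma>" "x \<in> carrier K"
  shows "conj_by K \<Gamma> i (\<gamma> \<otimes>\<^bsub>\<Gamma>\<^esub> \<delta>) x = conj_by K \<Gamma> i \<delta> (conj_by K \<Gamma> i \<gamma> x)"
proof (rule conj_by_eqI)
  have "i x \<otimes>\<^bsub>\<Gamma>\<^esub> (\<gamma> \<otimes>\<^bsub>\<Gamma>\<^esub> \<delta>) = \<gamma> \<otimes>\<^bsub>\<Gamma>\<^esub> i (conj_by K \<Gamma> i \<gamma> x) \<otimes>\<^bsub>\<Gamma>\<^esub> \<delta>"
    using assms by (simp add: i_closed i_mult_conj_by[of \<gamma> x] flip: \<Gamma>.m_assoc)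
  also have "\<dots> = \<gamma> \<otimes>\<^bsub>\<Gamma>\<^esub> (\<delta> \<otimes>\<^bsub>\<Gamma>\<^esub> i (conj_by K \<Gamma> i \<delta> (conj_by K \<Gamma> i \<gamma> x)))"
    using assms by (simp add: i_closed conj_by_closed \<Gamma>.m_assoc i_mult_conj_by[of \<delta>])
  finally show "i x \<otimes>\<^bsub>\<Gamma>\<^esub> (\<gamma> \<otimes>\<^bsub>\<Gamma>\<^esub> \<delta>) =
      \<gamma> \<otimes>\<^bsub>\<Gamma>\<^esub> \<delta> \<otimes>\<^bsub>\<Gamma>\<^esub> i (conj_by K \<Gamma> i \<delta> (conj_by K \<Gamma> i \<gamma> x))"
    using assms by (simp add: i_closed conj_by_closed \<Gamma>.m_assoc)
qed (use assms conj_by_closed in auto)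

lemma conj_by_i:
  assumes "x \<in> carrier K" "y \<in> carrier K"
  shows "y \<otimes>\<^bsub>K\<^esub> conj_by K \<Gamma> i (i y) x = x \<otimes>\<^bsub>K\<^esub> y"
proof -
  have "i (y \<otimes>\<^bsub>K\<^esub> conj_by K \<Gamma> i (i y) x) = i (x \<otimes>\<^bsub>K\<^esub> y)"
    using assms i_mult_conj_by[of "i y" x] by (simp add: i_mult i_closed conj_by_closed)
  then show ?thesis
    using assms i_inj by (auto dest!: inj_onD simp: conj_by_closed i_closed)
qed

text \<open>Under the sign convention of the hypothesis, \<open>k\<^sub>1\<close> is
  \<open>k\<^sub>2\<close> plus the coboundary of \<open>- v\<close>, so a witness \<open>w\<close>
  for membership in the first class becomes \<open>w - v\<close> for the second.\<close>

lemma crossed_hom_class_eqI: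
  assumes v: "\<And>x y. x \<in> carrier K \<Longrightarrow> y \<in> carrier K \<Longrightarrow> v (x \<otimes>\<^bsub>K\<^esub> y) = v x + v y"
    and eq: "\<And>\<gamma> x. \<gamma> \<in> carrier \<Gamma> \<Longrightarrow> x \<in> carrier K \<Longrightarrow>
      k\<^sub>1 (p \<gamma>) x = k\<^sub>2 (p \<gamma>) x + v x - v (conj_by K \<Gamma> i \<gamma> x)"
  shows "crossed_hom_class G (H1_int K) (G_action K \<Gamma> i p) k\<^sub>1 =
    crossed_hom_class G (H1_int K) (G_action K \<Gamma> i p) k\<^sub>2"
proof -
  \<comment> \<open>Stated for arbitrary data so that the reverse inclusion is the same fact with
    \<open>- v\<close>.\<close>
  have le: "crossed_hom_class G (H1_int K) (G_action K \<Gamma> i p) k\<^sub>1 \<subseteq>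
      crossed_hom_class G (H1_int K) (G_action K \<Gamma> i p) k\<^sub>2"
    if v: "\<And>x y. x \<in> carrier K \<Longrightarrow> y \<in> carrier K \<Longrightarrow> v (x \<otimes>\<^bsub>K\<^esub> y) = v x + v y"
      and eq: "\<And>\<gamma> x. \<gamma> \<in> carrier \<Gamma> \<Longrightarrow> x \<in> carrier K \<Longrightarrow>
        k\<^sub>1 (p \<gamma>) x = k\<^sub>2 (p \<gamma>) x + v x - v (conj_by K \<Gamma> i \<gamma> x)"
    for k\<^sub>1 k\<^sub>2 :: "'q \<Rightarrow> 'k \<Rightarrow> int" and v :: "'k \<Rightarrow> int"
  proof
    fix f assume "f \<in> crossed_hom_class G (H1_int K) (G_action K \<Gamma> i p) k\<^sub>1"
    then obtain w where f: "f \<in> extensional (tuples G 1)" and w: "w \<in> carrier (H1_int K)"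
      and fw: "\<And>g. g \<in> carrier G \<Longrightarrow>
        f [g] = (\<lambda>x \<in> carrier K. G_action K \<Gamma> i p g w x - w x + k\<^sub>1 g x)"
      by (auto simp: mem_crossed_hom_class_H1_int[OF group_K])
    have "(\<lambda>x \<in> carrier K. w x - v x) \<in> carrier (H1_int K)"
      using w v by (intro restrict_in_H1_int[OF group_K]) (auto simp: carrier_H1_int hom_mult)
    \<comment> \<open>The hypothesis is used at the very preimage of \<open>g\<close> that
      \<open>G_action\<close> picks.\<close>
    moreover have "f [g] = (\<lambda>x \<in> carrier K. G_action K \<Gamma> i p g (\<lambda>x \<in> carrier K. w x - v x) x
        - (\<lambda>x \<in> carrier K. w x - v x) x + k\<^sub>2 g x)" if "g \<in> carrier G" for g
      using eq[OF p_lift(1)[OF that]] p_lift[OF that]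
      by (auto simp: fw[OF that] G_action_def \<Gamma>_action_def conj_by_closed fun_eq_iff)
    ultimately show "f \<in> crossed_hom_class G (H1_int K) (G_action K \<Gamma> i p) k\<^sub>2"
      unfolding mem_crossed_hom_class_H1_int[OF group_K] using f by blast
  qed
  show ?thesis
  proof
    show "crossed_hom_class G (H1_int K) (G_action K \<Gamma> i p) k\<^sub>1 \<subseteq>
        crossed_hom_class G (H1_int K) (G_action K \<Gamma> i p) k\<^sub>2"
      by (rule le[where v = v]) (use v eq in auto)
    show "crossed_hom_class G (H1_int K) (G_action K \<Gamma> i p) k\<^sub>2 \<subseteq>
        crossed_hom_class G (H1_int K) (G_action K \<Gamma> i p) k\<^sub>1"
      by (rule le[where v = "\<lambda>x. - v x"]) (use v eq in auto)
  qed
qed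

section \<open>Evaluating \<phi> on cocycles in \<open>A12\<close>\<close>

lemma A12_cong:
  "f \<in> A12 \<Gamma> p \<Longrightarrow> \<gamma> \<in> carrier \<Gamma> \<Longrightarrow> \<beta> \<in> carrier \<Gamma> \<Longrightarrow> \<beta>' \<in> carrier \<Gamma> \<Longrightarrow> p \<beta> = p \<beta>' \<Longrightarrow>
    f [\<gamma>, \<beta>] = f [\<gamma>, \<beta>']"
  unfolding A12_def by blast

lemma A12_crossed_hom_p:
  assumes "f \<in> A12 \<Gamma> p" "\<gamma> \<in> carrier \<Gamma>" "x \<in> carrier K"
  shows "A12_crossed_hom K \<Gamma> G i p f (p \<gamma>) x = f [i x, \<gamma>]"
  using assms A12_cong[OF assms(1) i_closed[OF assms(3)] p_lift(1)[OF p_closed[OF assms(2)]] assms(2)]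
    p_lift(2)[OF p_closed[OF assms(2)]] by (simp add: A12_crossed_hom_def p_closed)

text \<open>
  If \<open>w\<close> bounds the difference of two cocycles in \<open>A12\<close>, evaluating at \<open>(\<gamma>, x)\<close> with \<open>x \<in> K\<close>
  gives \<open>w (\<gamma> x) = w \<gamma> + w x\<close>; so \<open>w\<close> restricts to a homomorphism on \<open>K\<close>, and the two crossed
  homomorphisms differ by the principal one given by that restriction.
\<close>

lemma seven_term_phi_eq:
  assumes f: "f \<in> cohomology_class \<Gamma> integer_group trivial_action 2 c" "f \<in> A12 \<Gamma> p"
  shows "seven_term_phi K \<Gamma> G i p (cohomology_class \<Gamma> integer_group trivial_action 2 c) =
    crossed_hom_class G (H1_int K) (G_action K \<Gamma> i p) (A12_crossed_hom K \<Gamma> G i p f)"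
  unfolding seven_term_phi_def
proof (rule the_equality)
  fix D assume "\<exists>f' \<in> cohomology_class \<Gamma> integer_group trivial_action 2 c \<inter> A12 \<Gamma> p.
    D = crossed_hom_class G (H1_int K) (G_action K \<Gamma> i p) (A12_crossed_hom K \<Gamma> G i p f')"
  then obtain f' where f': "f' \<in> cohomology_class \<Gamma> integer_group trivial_action 2 c"
      "f' \<in> A12 \<Gamma> p"
    and D: "D = crossed_hom_class G (H1_int K) (G_action K \<Gamma> i p) (A12_crossed_hom K \<Gamma> G i p f')"
    by blast
  obtain u where u: "\<And>a b. a \<in> carrier \<Gamma> \<Longrightarrow> b \<in> carrier \<Gamma> \<Longrightarrow>
      f [a, b] = u b - u (a \<otimes>\<^bsub>\<Gamma>\<^esub> b) + u a + c [a, b]"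
    using f(1) by (auto simp: mem_cohomology_class_2[OF \<Gamma>.is_monoid])
  obtain u' where u': "\<And>a b. a \<in> carrier \<Gamma> \<Longrightarrow> b \<in> carrier \<Gamma> \<Longrightarrow>
      f' [a, b] = u' b - u' (a \<otimes>\<^bsub>\<Gamma>\<^esub> b) + u' a + c [a, b]"
    using f'(1) by (auto simp: mem_cohomology_class_2[OF \<Gamma>.is_monoid])
  define w where "w a = u' a - u a" for a
  have w: "f' [a, b] = f [a, b] + w b - w (a \<otimes>\<^bsub>\<Gamma>\<^esub> b) + w a"
    if "a \<in> carrier \<Gamma>" "b \<in> carrier \<Gamma>" for a b
    using u[OF that] u'[OF that] by (simp add: w_def)
  have A12_i: "h [\<gamma>, i x] = 0" if "h \<in> A12 \<Gamma> p" "\<gamma> \<in> carrier \<Gamma>" "x \<in> carrier K" for h \<gamma> x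
  proof -
    have "h [\<gamma>, i x] = h [\<gamma>, \<one>\<^bsub>\<Gamma>\<^esub>]"
      using A12_cong[OF that(1,2) i_closed[OF that(3)] \<Gamma>.one_closed] p_i[OF that(3)] p_one by simp
    then show ?thesis
      using that by (simp add: A12_def)
  qed
  have w_i: "w (\<gamma> \<otimes>\<^bsub>\<Gamma>\<^esub> i x) = w \<gamma> + w (i x)" if "\<gamma> \<in> carrier \<Gamma>" "x \<in> carrier K" for \<gamma> x
    using w[OF that(1) i_closed[OF that(2)]] A12_i[OF f(2) that] A12_i[OF f'(2) that] by simp
  show "D = crossed_hom_class G (H1_int K) (G_action K \<Gamma> i p) (A12_crossed_hom K \<Gamma> G i p f)"
    unfolding D
  proof (rule crossed_hom_class_eqI[where v = "w \<circ> i"])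
    show "(w \<circ> i) (x \<otimes>\<^bsub>K\<^esub> y) = (w \<circ> i) x + (w \<circ> i) y"
      if "x \<in> carrier K" "y \<in> carrier K" for x y
      using that by (simp add: i_mult i_closed w_i)
    \<comment> \<open>At \<open>(i x, \<gamma>)\<close> the middle term of the coboundary of
      \<open>w\<close> is taken at \<open>i x \<gamma>\<close>. Rewriting this as
      \<open>\<gamma>\<close> times the conjugate of \<open>i x\<close> lets \<open>w_i\<close>
      split it, and \<open>w \<gamma>\<close> cancels.\<close>
    show "A12_crossed_hom K \<Gamma> G i p f' (p \<gamma>) x = A12_crossed_hom K \<Gamma> G i p f (p \<gamma>) x
        + (w \<circ> i) x - (w \<circ> i) (conj_by K \<Gamma> i \<gamma> x)" if "\<gamma> \<in> carrier \<Gamma>" "x \<in> carrier K" for \<gamma> x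
      using that w[of "i x" \<gamma>]
      by (simp add: A12_crossed_hom_p f f' i_closed i_mult_conj_by[of \<gamma> x] conj_by_closed w_i)
  qed
qed (use f in blast)

end

section \<open>The translation crossed homomorphism\<close>

locale lifted_extension = group_extension K \<Gamma> G i p
  for K :: "'k monoid" and \<Gamma> :: "'g monoid" and G :: "'q monoid"
    and i :: "'k \<Rightarrow> 'g" and p :: "'g \<Rightarrow> 'q" +
  fixes \<rho> :: "'g \<Rightarrow> circle \<Rightarrow> circle" and \<rho>' :: "'k \<Rightarrow> real \<Rightarrow> real"
  assumes \<rho>_hom: "\<rho> \<in> hom \<Gamma> Homeo_plus" and lifts: "lifts_hom K (\<rho> \<circ> i) \<rho>'"
begin

lemma lift_mult: "x \<in> carrier K \<Longrightarrow> y \<in> carrier K \<Longrightarrow> \<rho>' (x \<otimes>\<^bsub>K\<^esub> y) = \<rho>' x \<circ> \<rho>' y"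
  using lifts by (simp add: lifts_hom_def hom_def Homeo_cover_def)

lemma is_lift_lift: "x \<in> carrier K \<Longrightarrow> is_lift (\<rho>' x) (\<rho> (i x))"
  using lifts by (simp add: lifts_hom_def)

lemma degree_one_lift: "x \<in> carrier K \<Longrightarrow> degree_one (\<rho>' x)"
  using is_lift_lift is_lift_degree_one by blast

lemma \<rho>_mult: "a \<in> carrier \<Gamma> \<Longrightarrow> b \<in> carrier \<Gamma> \<Longrightarrow> \<rho> (a \<otimes>\<^bsub>\<Gamma>\<^esub> b) = \<rho> a \<circ> \<rho> b"
  using Homeo_plus_hom_comp[OF \<rho>_hom] .

text \<open>Membership in \<open>hom\<close> only gives multiplicativity, so the image of the unit
  is an idempotent; being injective, it is the identity.\<close>

lemma lift_one: "\<rho>' \<one>\<^bsub>K\<^esub> = id"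
proof
  fix t
  have "\<rho>' \<one>\<^bsub>K\<^esub> (\<rho>' \<one>\<^bsub>K\<^esub> t) = \<rho>' \<one>\<^bsub>K\<^esub> t"
    using lift_mult[of "\<one>\<^bsub>K\<^esub>" "\<one>\<^bsub>K\<^esub>"] by (simp add: fun_eq_iff)
  moreover have "inj (\<rho>' \<one>\<^bsub>K\<^esub>)"
    using is_lift_lift[of "\<one>\<^bsub>K\<^esub>"]
    by (auto simp: is_lift_def Homeo_cover_iff strict_mono_imp_inj_on)
  ultimately show "\<rho>' \<one>\<^bsub>K\<^esub> t = id t"
    by (simp add: inj_eq)
qed

text \<open>Both composites lift the same circle homeomorphism, since \<open>i x \<gamma>\<close>
  equals \<open>\<gamma>\<close> times the conjugate of \<open>i x\<close>.\<close>

lemma lift_conj: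
  assumes S: "is_lift S (\<rho> \<gamma>)" and \<gamma>: "\<gamma> \<in> carrier \<Gamma>" and x: "x \<in> carrier K"
  obtains m :: int where "\<And>t. \<rho>' x (S t) = S (\<rho>' (conj_by K \<Gamma> i \<gamma> x) t) + of_int m"
proof -
  have "\<rho> (i x) \<circ> \<rho> \<gamma> = \<rho> \<gamma> \<circ> \<rho> (i (conj_by K \<Gamma> i \<gamma> x))"
    using \<gamma> x i_mult_conj_by[OF \<gamma> x] \<rho>_mult
    by (metis conj_by_closed i_closed)
  then have "is_lift (\<rho>' x \<circ> S) (\<rho> \<gamma> \<circ> \<rho> (i (conj_by K \<Gamma> i \<gamma> x)))"
    using is_lift_comp[OF is_lift_lift[OF x] S] by simp
  then obtain m :: int
    where "\<And>t. (\<rho>' x \<circ> S) t = (S \<circ> \<rho>' (conj_by K \<Gamma> i \<gamma> x)) t + of_int m"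
    using is_lift_unique[OF is_lift_comp[OF S is_lift_lift[OF conj_by_closed[OF \<gamma> x]]]] by blast
  then have "\<rho>' x (S t) = S (\<rho>' (conj_by K \<Gamma> i \<gamma> x) t) + of_int m" for t
    by simp
  then show ?thesis by (rule that)
qed

text \<open>The lift \<open>S\<close> plays the role of the semi-conjugacy, so \<open>m\<close> is
  visible in the translation numbers.\<close>

lemma translation_number_conj:
  assumes S: "is_lift S (\<rho> \<gamma>)" and \<gamma>: "\<gamma> \<in> carrier \<Gamma>" and x: "x \<in> carrier K"
    and eq: "\<And>t. \<rho>' x (S t) = S (\<rho>' (conj_by K \<Gamma> i \<gamma> x) t) + of_int m"
  shows "translation_number (\<rho>' x) - translation_number (\<rho>' (conj_by K \<Gamma> i \<gamma> x)) = of_int m"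
  using translation_number_semi_conj[OF degree_one_lift[OF x]
      degree_one_lift[OF conj_by_closed[OF \<gamma> x]] is_lift_degree_one[OF S] eq] by simp

text \<open>The desired crossed homomorphism, seen on \<Gamma> before descending to
  \<open>G\<close>. The floor only converts the type: \<open>of_int_displacement\<close> shows that
  the difference is an integer.\<close>

definition displacement :: "'g \<Rightarrow> 'k \<Rightarrow> int" where
  "displacement \<gamma> x =
    \<lfloor>translation_number (\<rho>' x) - translation_number (\<rho>' (conj_by K \<Gamma> i \<gamma> x))\<rfloor>"

lemma is_lift_some_lift_\<rho>: "\<gamma> \<in> carrier \<Gamma> \<Longrightarrow> is_lift (some_lift (\<rho> \<gamma>)) (\<rho> \<gamma>)"
  using is_lift_some_lift hom_in_carrier[OF \<rho>_hom] by blast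

lemma lift_conj_displacement:
  assumes S: "is_lift S (\<rho> \<gamma>)" and \<gamma>: "\<gamma> \<in> carrier \<Gamma>" and x: "x \<in> carrier K"
  shows "\<rho>' x (S t) = S (\<rho>' (conj_by K \<Gamma> i \<gamma> x) t) + of_int (displacement \<gamma> x)"
proof -
  obtain m :: int where m: "\<And>t. \<rho>' x (S t) = S (\<rho>' (conj_by K \<Gamma> i \<gamma> x) t) + of_int m"
    using lift_conj[OF assms] by metis
  then have "displacement \<gamma> x = m"
    using translation_number_conj[OF assms m] by (simp add: displacement_def)
  then show ?thesis
    using m by simp
qed

lemma of_int_displacement:
  assumes \<gamma>: "\<gamma> \<in> carrier \<Gamma>" and x: "x \<in> carrier K"
  shows "real_of_int (displacement \<gamma> x) =
    translation_number (\<rho>' x) - translation_number (\<rho>' (conj_by K \<Gamma> i \<gamma> x))"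
  using translation_number_conj[OF is_lift_some_lift_\<rho>[OF \<gamma>] \<gamma> x]
    lift_conj_displacement[OF is_lift_some_lift_\<rho>[OF \<gamma>] \<gamma> x] by simp

text \<open>Translation numbers need not be additive. Additivity comes instead from the commutation
  relation in \<open>lift_conj_displacement\<close>: moving one lift past two factors adds up the
  two integers.\<close>

lemma displacement_mult:
  assumes \<gamma>: "\<gamma> \<in> carrier \<Gamma>" and x: "x \<in> carrier K" and y: "y \<in> carrier K"
  shows "displacement \<gamma> (x \<otimes>\<^bsub>K\<^esub> y) = displacement \<gamma> x + displacement \<gamma> y"
proof -
  let ?S = "some_lift (\<rho> \<gamma>)" and ?c = "conj_by K \<Gamma> i \<gamma>"
  note S = is_lift_some_lift_\<rho>[OF \<gamma>]
  have "?S (\<rho>' (?c (x \<otimes>\<^bsub>K\<^esub> y)) 0) + of_int (displacement \<gamma> (x \<otimes>\<^bsub>K\<^esub> y)) = \<rho>' (x \<otimes>\<^bsub>K\<^esub> y) (?S 0)"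
    using lift_conj_displacement[OF S \<gamma>] x y by simp
  also have "\<dots> = \<rho>' x (?S (\<rho>' (?c y) 0) + of_int (displacement \<gamma> y))"
    using lift_conj_displacement[OF S \<gamma> y, of 0] x y by (simp add: lift_mult)
  also have "\<dots> = ?S (\<rho>' (?c x) (\<rho>' (?c y) 0)) + of_int (displacement \<gamma> x) + of_int (displacement \<gamma> y)"
    using lift_conj_displacement[OF S \<gamma> x] degree_one_of_int[OF degree_one_lift[OF x]] by simp
  also have "\<rho>' (?c x) (\<rho>' (?c y) 0) = \<rho>' (?c (x \<otimes>\<^bsub>K\<^esub> y)) 0"
    using \<gamma> x y by (simp add: conj_by_mult conj_by_closed lift_mult)
  finally have "real_of_int (displacement \<gamma> (x \<otimes>\<^bsub>K\<^esub> y)) =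
      of_int (displacement \<gamma> x + displacement \<gamma> y)"
    by simp
  then show ?thesis by (simp only: of_int_eq_iff)
qed

text \<open>For \<open>\<gamma> = i y\<close> the lift \<open>\<rho>' y\<close> can be used, and the
  relation holds exactly inside the homomorphism \<open>\<rho>'\<close>, with integer 0.\<close>

lemma displacement_i:
  assumes x: "x \<in> carrier K" and y: "y \<in> carrier K"
  shows "displacement (i y) x = 0"
proof -
  have "\<rho>' x (\<rho>' y t) = \<rho>' y (\<rho>' (conj_by K \<Gamma> i (i y) x) t) + of_int 0" for t
    using conj_by_i[OF x y] lift_mult[OF x y]
      lift_mult[OF y conj_by_closed[OF i_closed[OF y] x]] by (simp add: fun_eq_iff)
  then have "translation_number (\<rho>' x) - translation_number (\<rho>' (conj_by K \<Gamma> i (i y) x)) = of_int 0"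
    by (rule translation_number_conj[OF is_lift_lift[OF y] i_closed[OF y] x])
  then show ?thesis
    by (simp add: displacement_def)
qed

text \<open>The sum telescopes through the translation number at the conjugate of \<open>x\<close>
  by \<open>\<gamma>\<close>.\<close>

lemma displacement_comp:
  assumes \<gamma>: "\<gamma> \<in> carrier \<Gamma>" and \<delta>: "\<delta> \<in> carrier \<Gamma>" and x: "x \<in> carrier K"
  shows "displacement (\<gamma> \<otimes>\<^bsub>\<Gamma>\<^esub> \<delta>) x = displacement \<gamma> x + displacement \<delta> (conj_by K \<Gamma> i \<gamma> x)"
proof -
  have "real_of_int (displacement (\<gamma> \<otimes>\<^bsub>\<Gamma>\<^esub> \<delta>) x) =
      of_int (displacement \<gamma> x + displacement \<delta> (conj_by K \<Gamma> i \<gamma> x))"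
    using assms by (simp add: of_int_displacement conj_by_closed conj_by_comp)
  then show ?thesis by (simp only: of_int_eq_iff)
qed

text \<open>Two preimages of one element of \<open>G\<close> differ by some \<open>i y\<close>,
  which contributes 0; this is the descent to \<open>G\<close>.\<close>

lemma displacement_cong:
  assumes \<gamma>: "\<gamma> \<in> carrier \<Gamma>" and \<gamma>': "\<gamma>' \<in> carrier \<Gamma>" and p: "p \<gamma> = p \<gamma>'" and x: "x \<in> carrier K"
  shows "displacement \<gamma> x = displacement \<gamma>' x"
proof -
  obtain y where "y \<in> carrier K" "\<gamma>' = \<gamma> \<otimes>\<^bsub>\<Gamma>\<^esub> i y"
    using same_p[OF \<gamma> \<gamma>' p] .
  then show ?thesis
    using \<gamma> x by (simp add: displacement_comp displacement_i i_closed conj_by_closed)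
qed

text \<open>Evaluates at the same preimage as \<open>G_action\<close> and
  \<open>A12_crossed_hom\<close>, so comparison with them is by unfolding.\<close>

definition translation_crossed_hom :: "'q \<Rightarrow> 'k \<Rightarrow> int" where
  "translation_crossed_hom =
    (\<lambda>g \<in> carrier G. \<lambda>x \<in> carrier K. displacement (inv_into (carrier \<Gamma>) p g) x)"

lemma translation_crossed_hom_p:
  "\<gamma> \<in> carrier \<Gamma> \<Longrightarrow> x \<in> carrier K \<Longrightarrow> translation_crossed_hom (p \<gamma>) x = displacement \<gamma> x"
  by (simp add: translation_crossed_hom_def p_closed)
    (meson displacement_cong p_closed p_lift)

lemma is_translation_crossed_hom: "is_translation_crossed_hom K \<Gamma> G i p \<rho>' translation_crossed_hom"
  unfolding is_translation_crossed_hom_def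
proof (intro conjI ballI)
  fix \<gamma> x assume "\<gamma> \<in> carrier \<Gamma>" "x \<in> carrier K"
  then show "real_of_int (translation_crossed_hom (p \<gamma>) x) =
      translation_number (\<rho>' x) - translation_number (\<rho>' (conj_by K \<Gamma> i \<gamma> x))"
    by (simp add: translation_crossed_hom_p of_int_displacement)
next
  have "translation_crossed_hom (g \<otimes>\<^bsub>G\<^esub> h) = translation_crossed_hom g
      \<otimes>\<^bsub>H1_int K\<^esub> G_action K \<Gamma> i p g (translation_crossed_hom h)"
    if g: "g \<in> carrier G" and h: "h \<in> carrier G" for g h
  proof
    fix x
    let ?\<gamma> = "inv_into (carrier \<Gamma>) p g" and ?\<delta> = "inv_into (carrier \<Gamma>) p h"
    note \<gamma> = p_lift[OF g] and \<delta> = p_lift[OF h]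
    have gh: "p (?\<gamma> \<otimes>\<^bsub>\<Gamma>\<^esub> ?\<delta>) = g \<otimes>\<^bsub>G\<^esub> h"
      using \<gamma> \<delta> by (simp add: p_mult)
    show "translation_crossed_hom (g \<otimes>\<^bsub>G\<^esub> h) x = (translation_crossed_hom g
      \<otimes>\<^bsub>H1_int K\<^esub> G_action K \<Gamma> i p g (translation_crossed_hom h)) x"
    proof (cases "x \<in> carrier K")
      case x: True
      have "translation_crossed_hom (g \<otimes>\<^bsub>G\<^esub> h) x = displacement (?\<gamma> \<otimes>\<^bsub>\<Gamma>\<^esub> ?\<delta>) x"
        using translation_crossed_hom_p[OF _ x, of "?\<gamma> \<otimes>\<^bsub>\<Gamma>\<^esub> ?\<delta>"] \<gamma> \<delta> gh by simp
      also have "\<dots> = displacement ?\<gamma> x + displacement ?\<delta> (conj_by K \<Gamma> i ?\<gamma> x)"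
        using \<gamma> \<delta> x displacement_comp by blast
      finally show ?thesis
        using g h x \<gamma>
        by (simp add: mult_H1_int G_action_def \<Gamma>_action_def translation_crossed_hom_def conj_by_closed)
    qed (use g h in \<open>simp add: mult_H1_int translation_crossed_hom_def\<close>)
  qed
  moreover have "translation_crossed_hom \<in> carrier G \<rightarrow>\<^sub>E carrier (H1_int K)"
    using p_lift(1) by (auto simp: translation_crossed_hom_def displacement_mult
        intro!: restrict_in_H1_int[OF group_K])
  ultimately show "translation_crossed_hom \<in> crossed_homs G (H1_int K) (G_action K \<Gamma> i p)"
    by (simp add: crossed_homs_def)
qed

lemma is_translation_crossed_hom_p:
  assumes "is_translation_crossed_hom K \<Gamma> G i p \<rho>' k" "\<gamma> \<in> carrier \<Gamma>" "x \<in> carrier K"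
  shows "k (p \<gamma>) x = displacement \<gamma> x"
  using assms of_int_displacement[OF assms(2,3)]
  unfolding is_translation_crossed_hom_def by (metis of_int_eq_iff)

text \<open>As \<open>p\<close> is onto, the prescribed values at \<open>p \<gamma>\<close>
  determine everything on the carriers; extensionality settles the rest.\<close>

lemma is_translation_crossed_hom_unique:
  assumes k: "is_translation_crossed_hom K \<Gamma> G i p \<rho>' k"
  shows "k = translation_crossed_hom"
proof -
  have ext: "k \<in> carrier G \<rightarrow>\<^sub>E carrier (H1_int K)"
    "translation_crossed_hom \<in> carrier G \<rightarrow>\<^sub>E carrier (H1_int K)"
    using k is_translation_crossed_hom by (auto simp: is_translation_crossed_hom_def crossed_homs_def)
  show ?thesis
  proof (rule PiE_ext[OF ext])
    fix g assume g: "g \<in> carrier G"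
    then have "k g \<in> extensional (carrier K)" "translation_crossed_hom g \<in> extensional (carrier K)"
      using ext by (auto simp: carrier_H1_int)
    then show "k g = translation_crossed_hom g"
    proof (rule extensionalityI)
      fix x assume "x \<in> carrier K"
      then show "k g x = translation_crossed_hom g x"
        using is_translation_crossed_hom_p[OF k p_lift(1)[OF g]]
          translation_crossed_hom_p[OF p_lift(1)[OF g]] p_lift(2)[OF g] by simp
    qed
  qed
qed

text \<open>Choose lifts on coset representatives of \<open>K\<close>, and extend to each coset by \<open>\<rho>'\<close>.\<close>

lemma equivariant_section:
  obtains \<sigma> where "\<And>\<gamma>. \<gamma> \<in> carrier \<Gamma> \<Longrightarrow> is_lift (\<sigma> \<gamma>) (\<rho> \<gamma>)" "\<sigma> \<one>\<^bsub>\<Gamma>\<^esub> = id"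
    "\<And>\<gamma> x. \<gamma> \<in> carrier \<Gamma> \<Longrightarrow> x \<in> carrier K \<Longrightarrow> \<sigma> (\<gamma> \<otimes>\<^bsub>\<Gamma>\<^esub> i x) = \<sigma> \<gamma> \<circ> \<rho>' x"
proof -
  \<comment> \<open>The trivial coset gets representative 1 with lift \<open>id\<close>; this yields
    the normalization of the cocycle.\<close>
  define r where "r g = (if g = \<one>\<^bsub>G\<^esub> then \<one>\<^bsub>\<Gamma>\<^esub> else inv_into (carrier \<Gamma>) p g)" for g
  define S where "S g = (if g = \<one>\<^bsub>G\<^esub> then id else some_lift (\<rho> (r g)))" for g
  \<comment> \<open>The component of \<open>\<gamma>\<close> in \<open>K\<close> relative to its
    coset representative.\<close>
  define \<kappa> where "\<kappa> \<gamma> = inv_into (carrier K) i (inv\<^bsub>\<Gamma>\<^esub> r (p \<gamma>) \<otimes>\<^bsub>\<Gamma>\<^esub> \<gamma>)" for \<gamma>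
  define \<sigma> where "\<sigma> \<gamma> = S (p \<gamma>) \<circ> \<rho>' (\<kappa> \<gamma>)" for \<gamma>
  have r: "r g \<in> carrier \<Gamma>" "p (r g) = g" if "g \<in> carrier G" for g
    using p_lift[OF that] p_one by (auto simp: r_def)
  have "is_lift id (\<rho> \<one>\<^bsub>\<Gamma>\<^esub>)"
    using is_lift_lift[of "\<one>\<^bsub>K\<^esub>"] by (simp add: i_one lift_one)
  then have S: "is_lift (S g) (\<rho> (r g))" if "g \<in> carrier G" for g
    using is_lift_some_lift_\<rho>[OF r(1)[OF that]] by (auto simp: S_def r_def)
  have \<kappa>: "\<kappa> (r g \<otimes>\<^bsub>\<Gamma>\<^esub> i x) = x" if "g \<in> carrier G" "x \<in> carrier K" for g x
    using that r[OF that(1)] i_inj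
    by (simp add: \<kappa>_def p_mult_i i_closed inv_into_f_f flip: \<Gamma>.m_assoc)
  have \<sigma>_eq: "\<sigma> (r g \<otimes>\<^bsub>\<Gamma>\<^esub> i x) = S g \<circ> \<rho>' x" if "g \<in> carrier G" "x \<in> carrier K" for g x
    using that r[OF that(1)] by (simp add: \<sigma>_def \<kappa> p_mult_i)
  have decomp: "\<exists>g \<in> carrier G. \<exists>x \<in> carrier K. \<gamma> = r g \<otimes>\<^bsub>\<Gamma>\<^esub> i x" if "\<gamma> \<in> carrier \<Gamma>" for \<gamma>
    using same_p[of "r (p \<gamma>)" \<gamma>] r[of "p \<gamma>"] that p_closed by metis
  show ?thesis
  proof
    fix \<gamma> assume "\<gamma> \<in> carrier \<Gamma>"
    then obtain g x where gx: "g \<in> carrier G" "x \<in> carrier K" "\<gamma> = r g \<otimes>\<^bsub>\<Gamma>\<^esub> i x"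
      using decomp by blast
    then show "is_lift (\<sigma> \<gamma>) (\<rho> \<gamma>)"
      using is_lift_comp[OF S is_lift_lift] r(1) by (simp add: \<sigma>_eq \<rho>_mult i_closed)
    fix y assume y: "y \<in> carrier K"
    have "\<gamma> \<otimes>\<^bsub>\<Gamma>\<^esub> i y = r g \<otimes>\<^bsub>\<Gamma>\<^esub> i (x \<otimes>\<^bsub>K\<^esub> y)"
      using gx y r(1) by (simp add: i_mult i_closed \<Gamma>.m_assoc)
    then show "\<sigma> (\<gamma> \<otimes>\<^bsub>\<Gamma>\<^esub> i y) = \<sigma> \<gamma> \<circ> \<rho>' y"
      using gx y by (simp add: \<sigma>_eq lift_mult comp_assoc)
  next
    have "\<sigma> (r \<one>\<^bsub>G\<^esub> \<otimes>\<^bsub>\<Gamma>\<^esub> i \<one>\<^bsub>K\<^esub>) = id"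
      by (simp add: \<sigma>_eq S_def lift_one)
    then show "\<sigma> \<one>\<^bsub>\<Gamma>\<^esub> = id"
      by (simp add: r_def i_one)
  qed
qed

lemma translation_crossed_hom_class:
  "crossed_hom_class G (H1_int K) (G_action K \<Gamma> i p) translation_crossed_hom =
    seven_term_phi K \<Gamma> G i p (euler_class_of \<Gamma> \<rho>)"
proof -
  obtain \<sigma> where \<sigma>: "\<And>\<gamma>. \<gamma> \<in> carrier \<Gamma> \<Longrightarrow> is_lift (\<sigma> \<gamma>) (\<rho> \<gamma>)" and \<sigma>_one: "\<sigma> \<one>\<^bsub>\<Gamma>\<^esub> = id"
    and \<sigma>_i: "\<And>\<gamma> x. \<gamma> \<in> carrier \<Gamma> \<Longrightarrow> x \<in> carrier K \<Longrightarrow> \<sigma> (\<gamma> \<otimes>\<^bsub>\<Gamma>\<^esub> i x) = \<sigma> \<gamma> \<circ> \<rho>' x"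
    using equivariant_section by blast
  have "\<exists>n :: int. \<forall>t. \<sigma> a (\<sigma> b t) = \<sigma> (a \<otimes>\<^bsub>\<Gamma>\<^esub> b) t + of_int n"
    if a: "a \<in> carrier \<Gamma>" and b: "b \<in> carrier \<Gamma>" for a b
  proof -
    have "is_lift (\<sigma> (a \<otimes>\<^bsub>\<Gamma>\<^esub> b)) (\<rho> a \<circ> \<rho> b)"
      using \<sigma>[of "a \<otimes>\<^bsub>\<Gamma>\<^esub> b"] \<rho>_mult a b by simp
    then obtain n :: int where "\<And>t. (\<sigma> a \<circ> \<sigma> b) t = \<sigma> (a \<otimes>\<^bsub>\<Gamma>\<^esub> b) t + of_int n"
      using is_lift_unique is_lift_comp[OF \<sigma>[OF a] \<sigma>[OF b]] by blast
    then show ?thesis by auto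
  qed
  then obtain n :: "'g \<Rightarrow> 'g \<Rightarrow> int" where n: "\<And>a b t. a \<in> carrier \<Gamma> \<Longrightarrow> b \<in> carrier \<Gamma> \<Longrightarrow>
      \<sigma> a (\<sigma> b t) = \<sigma> (a \<otimes>\<^bsub>\<Gamma>\<^esub> b) t + of_int (n a b)"
    by metis
  define f where "f = (\<lambda>gs \<in> tuples \<Gamma> 2. n (gs ! 0) (gs ! 1))"
  have f_eq: "f [a, b] = n a b" if "a \<in> carrier \<Gamma>" "b \<in> carrier \<Gamma>" for a b
    using that by (simp add: f_def tuples_def)
  have f_euler: "f \<in> euler_class_of \<Gamma> \<rho>"
    by (rule section_cocycle_in_euler_class[OF \<Gamma>.is_monoid \<rho>_hom \<sigma>])
      (auto simp: f_eq n, simp add: f_def)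
  have n_one: "n \<one>\<^bsub>\<Gamma>\<^esub> \<gamma> = 0" "n \<gamma> \<one>\<^bsub>\<Gamma>\<^esub> = 0" if "\<gamma> \<in> carrier \<Gamma>" for \<gamma>
    using n[OF that \<Gamma>.one_closed, of 0] n[OF \<Gamma>.one_closed that, of 0] that by (auto simp: \<sigma>_one)
  have n_cong: "n \<gamma> \<beta> = n \<gamma> \<beta>'"
    if \<gamma>: "\<gamma> \<in> carrier \<Gamma>" and \<beta>: "\<beta> \<in> carrier \<Gamma>" and \<beta>': "\<beta>' \<in> carrier \<Gamma>" and p: "p \<beta> = p \<beta>'"
    for \<gamma> \<beta> \<beta>'
  proof -
    obtain y where y: "y \<in> carrier K" "\<beta>' = \<beta> \<otimes>\<^bsub>\<Gamma>\<^esub> i y"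
      using same_p[OF \<beta> \<beta>' p] .
    have "\<gamma> \<otimes>\<^bsub>\<Gamma>\<^esub> \<beta>' = \<gamma> \<otimes>\<^bsub>\<Gamma>\<^esub> \<beta> \<otimes>\<^bsub>\<Gamma>\<^esub> i y"
      using \<gamma> \<beta> y by (simp add: i_closed \<Gamma>.m_assoc)
    \<comment> \<open>The points are chosen to match: \<open>\<sigma> \<beta>' 0\<close> is
      \<open>\<sigma> \<beta>\<close> at \<open>\<rho>' y 0\<close>, and likewise for the products
      with \<open>\<gamma>\<close>.\<close>
    then show ?thesis
      using n[OF \<gamma> \<beta>, of "\<rho>' y 0"] n[OF \<gamma> \<beta>', of 0] y \<gamma> \<beta> by (simp add: \<sigma>_i)
  qed
  have f_A12: "f \<in> A12 \<Gamma> p"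
    unfolding A12_def
  proof (intro CollectI conjI ballI impI)
    show "f \<in> carrier (cochain_group \<Gamma> integer_group 2)"
      by (simp add: f_def carrier_cochain_group)
  qed (simp_all add: f_eq n_one, rule n_cong)
  \<comment> \<open>Since \<open>\<sigma>\<close> restricts to \<open>\<rho>'\<close> on
    \<open>K\<close>, the cocycle relation at \<open>(i x, \<gamma>)\<close> is the commutation
    relation that defines the displacement; one point suffices to compare the integers.\<close>
  have "f [i x, \<gamma>] = displacement \<gamma> x" if \<gamma>: "\<gamma> \<in> carrier \<Gamma>" and x: "x \<in> carrier K" for \<gamma> x
  proof -
    have "\<sigma> (i x) = \<rho>' x"
      using \<sigma>_i[OF \<Gamma>.one_closed x] x by (simp add: \<sigma>_one i_closed)
    then have "\<rho>' x (\<sigma> \<gamma> 0) = \<sigma> \<gamma> (\<rho>' (conj_by K \<Gamma> i \<gamma> x) 0) + of_int (n (i x) \<gamma>)"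
      using n[OF i_closed[OF x] \<gamma>, of 0] i_mult_conj_by[OF \<gamma> x] \<sigma>_i[OF \<gamma> conj_by_closed[OF \<gamma> x]]
      by simp
    then show ?thesis
      using lift_conj_displacement[OF \<sigma>[OF \<gamma>] \<gamma> x, of 0] f_eq[OF i_closed[OF x] \<gamma>] by simp
  qed
  then have "A12_crossed_hom K \<Gamma> G i p f = translation_crossed_hom"
    using p_lift(1) by (auto simp: A12_crossed_hom_def translation_crossed_hom_def fun_eq_iff)
  then show ?thesis
    using seven_term_phi_eq[OF f_euler[unfolded euler_class_of_eq[OF \<Gamma>.is_monoid \<rho>_hom]] f_A12]
    by (simp add: euler_class_of_eq[OF \<Gamma>.is_monoid \<rho>_hom])
qed

end

text \<open>
  The semi-conjugacy \<open>h\<close> intertwines \<open>\<rho>\<^sub>1' x\<close> and \<open>\<rho>\<^sub>2' x\<close> up to a translation by an integer \<open>v x\<close>;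
  this \<open>v\<close> is a homomorphism equal to the difference of the two translation numbers.
\<close>

lemma (in group_extension) semi_conjugate_crossed_hom_class:
  assumes \<rho>\<^sub>1: "\<rho>\<^sub>1 \<in> hom \<Gamma> Homeo_plus" "lifts_hom K (\<rho>\<^sub>1 \<circ> i) \<rho>\<^sub>1'"
      "is_translation_crossed_hom K \<Gamma> G i p \<rho>\<^sub>1' k\<^sub>1"
    and \<rho>\<^sub>2: "\<rho>\<^sub>2 \<in> hom \<Gamma> Homeo_plus" "lifts_hom K (\<rho>\<^sub>2 \<circ> i) \<rho>\<^sub>2'"
      "is_translation_crossed_hom K \<Gamma> G i p \<rho>\<^sub>2' k\<^sub>2"
    and semi: "semi_conjugate \<Gamma> \<rho>\<^sub>1 \<rho>\<^sub>2"
  shows "crossed_hom_class G (H1_int K) (G_action K \<Gamma> i p) k\<^sub>1 =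
    crossed_hom_class G (H1_int K) (G_action K \<Gamma> i p) k\<^sub>2"
proof -
  interpret L1: lifted_extension K \<Gamma> G i p \<rho>\<^sub>1 \<rho>\<^sub>1'
    by unfold_locales (use \<rho>\<^sub>1 in auto)
  interpret L2: lifted_extension K \<Gamma> G i p \<rho>\<^sub>2 \<rho>\<^sub>2'
    by unfold_locales (use \<rho>\<^sub>2 in auto)
  obtain h where h: "degree_one h" and F: "\<And>\<gamma>. \<gamma> \<in> carrier \<Gamma> \<Longrightarrow>
      \<exists>F\<^sub>1 F\<^sub>2. is_lift F\<^sub>1 (\<rho>\<^sub>1 \<gamma>) \<and> is_lift F\<^sub>2 (\<rho>\<^sub>2 \<gamma>) \<and> F\<^sub>1 \<circ> h = h \<circ> F\<^sub>2"
    using semi unfolding semi_conjugate_def degree_one_def by blast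
  have "\<exists>n :: int. \<forall>t. \<rho>\<^sub>1' x (h t) = h (\<rho>\<^sub>2' x t) + of_int n" if x: "x \<in> carrier K" for x
  proof -
    obtain F\<^sub>1 F\<^sub>2 where F: "is_lift F\<^sub>1 (\<rho>\<^sub>1 (i x))" "is_lift F\<^sub>2 (\<rho>\<^sub>2 (i x))" "F\<^sub>1 \<circ> h = h \<circ> F\<^sub>2"
      using F[OF i_closed[OF x]] by blast
    obtain a :: int where a: "\<And>t. \<rho>\<^sub>1' x t = F\<^sub>1 t + of_int a"
      using is_lift_unique[OF F(1) L1.is_lift_lift[OF x]] by blast
    obtain b :: int where b: "\<And>t. \<rho>\<^sub>2' x t = F\<^sub>2 t + of_int b"
      using is_lift_unique[OF F(2) L2.is_lift_lift[OF x]] by blast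
    \<comment> \<open>The prescribed lifts differ from the intertwined ones by \<open>a\<close> and
      \<open>b\<close>, and \<open>h\<close> commutes with integer translations.\<close>
    have "\<rho>\<^sub>1' x (h t) = h (\<rho>\<^sub>2' x t) + of_int (a - b)" for t
      using fun_cong[OF F(3), of t] by (simp add: a b degree_one_of_int[OF h])
    then show ?thesis by blast
  qed
  then obtain v :: "'k \<Rightarrow> int"
    where v: "\<And>x t. x \<in> carrier K \<Longrightarrow> \<rho>\<^sub>1' x (h t) = h (\<rho>\<^sub>2' x t) + of_int (v x)"
    by metis
  have \<tau>: "translation_number (\<rho>\<^sub>1' x) = translation_number (\<rho>\<^sub>2' x) + of_int (v x)"
    if "x \<in> carrier K" for x
    using translation_number_semi_conj[OF L1.degree_one_lift[OF that] L2.degree_one_lift[OF that]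
        h v[OF that]] .
  show ?thesis
  proof (rule crossed_hom_class_eqI[where v = v])
    fix x y assume x: "x \<in> carrier K" and y: "y \<in> carrier K"
    have "h (\<rho>\<^sub>2' (x \<otimes>\<^bsub>K\<^esub> y) 0) + of_int (v (x \<otimes>\<^bsub>K\<^esub> y)) = \<rho>\<^sub>1' x (\<rho>\<^sub>1' y (h 0))"
      using v[of "x \<otimes>\<^bsub>K\<^esub> y" 0] x y L1.lift_mult[OF x y] by simp
    also have "\<dots> = h (\<rho>\<^sub>2' x (\<rho>\<^sub>2' y 0)) + of_int (v x) + of_int (v y)"
      using degree_one_of_int[OF L1.degree_one_lift[OF x]] by (simp add: v[OF x] v[OF y])
    also have "\<rho>\<^sub>2' x (\<rho>\<^sub>2' y 0) = \<rho>\<^sub>2' (x \<otimes>\<^bsub>K\<^esub> y) 0"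
      using L2.lift_mult[OF x y] by simp
    finally have "real_of_int (v (x \<otimes>\<^bsub>K\<^esub> y)) = of_int (v x + v y)"
      by simp
    then show "v (x \<otimes>\<^bsub>K\<^esub> y) = v x + v y" by (simp only: of_int_eq_iff)
  next
    fix \<gamma> x assume \<gamma>: "\<gamma> \<in> carrier \<Gamma>" and x: "x \<in> carrier K"
    have "real_of_int (k\<^sub>1 (p \<gamma>) x) = of_int (k\<^sub>2 (p \<gamma>) x + v x - v (conj_by K \<Gamma> i \<gamma> x))"
      using \<rho>\<^sub>1(3) \<rho>\<^sub>2(3) \<gamma> x \<tau>[OF x] \<tau>[OF conj_by_closed[OF \<gamma> x]]
      by (simp add: is_translation_crossed_hom_def)
    then show "k\<^sub>1 (p \<gamma>) x = k\<^sub>2 (p \<gamma>) x + v x - v (conj_by K \<Gamma> i \<gamma> x)"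
      by (simp only: of_int_eq_iff)
  qed
qed

theorem theorem1p1:
  fixes K :: "'k monoid" and \<Gamma> :: "'g monoid" and G :: "'q monoid"
    and i :: "'k \<Rightarrow> 'g" and p :: "'g \<Rightarrow> 'q"
  assumes "group_extension K \<Gamma> G i p"
  shows
    "(\<forall>\<rho> \<in> hom \<Gamma> Homeo_plus. euler_class_of \<Gamma> \<rho> \<in> Ker_res K \<Gamma> i \<longrightarrow>
        (\<exists>\<rho>'. lifts_hom K (\<rho> \<circ> i) \<rho>') \<and>
        (\<forall>\<rho>'. lifts_hom K (\<rho> \<circ> i) \<rho>' \<longrightarrow>
          (\<exists>!k. is_translation_crossed_hom K \<Gamma> G i p \<rho>' k) \<and>
          (\<forall>k. is_translation_crossed_hom K \<Gamma> G i p \<rho>' k \<longrightarrow>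
            crossed_hom_class G (H1_int K) (G_action K \<Gamma> i p) k =
              seven_term_phi K \<Gamma> G i p (euler_class_of \<Gamma> \<rho>))))
     \<and>
     (\<forall>\<rho>\<^sub>1 \<in> hom \<Gamma> Homeo_plus. \<forall>\<rho>\<^sub>2 \<in> hom \<Gamma> Homeo_plus.
        semi_conjugate \<Gamma> \<rho>\<^sub>1 \<rho>\<^sub>2 \<longrightarrow>
        euler_class_of \<Gamma> \<rho>\<^sub>1 \<in> Ker_res K \<Gamma> i \<longrightarrow> euler_class_of \<Gamma> \<rho>\<^sub>2 \<in> Ker_res K \<Gamma> i \<longrightarrow>
        (\<forall>\<rho>\<^sub>1' \<rho>\<^sub>2' k\<^sub>1 k\<^sub>2.
          lifts_hom K (\<rho>\<^sub>1 \<circ> i) \<rho>\<^sub>1' \<and> lifts_hom K (\<rho>\<^sub>2 \<circ> i) \<rho>\<^sub>2' \<and>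
          is_translation_crossed_hom K \<Gamma> G i p \<rho>\<^sub>1' k\<^sub>1 \<and>
          is_translation_crossed_hom K \<Gamma> G i p \<rho>\<^sub>2' k\<^sub>2 \<longrightarrow>
            crossed_hom_class G (H1_int K) (G_action K \<Gamma> i p) k\<^sub>1 =
            crossed_hom_class G (H1_int K) (G_action K \<Gamma> i p) k\<^sub>2))"
proof -
  interpret group_extension K \<Gamma> G i p
    by (rule assms)
  have loc: "lifted_extension K \<Gamma> G i p \<rho> \<rho>'"
    if "\<rho> \<in> hom \<Gamma> Homeo_plus" "lifts_hom K (\<rho> \<circ> i) \<rho>'" for \<rho> \<rho>'
    using that by unfold_locales
  have "\<exists>!k. is_translation_crossed_hom K \<Gamma> G i p \<rho>' k"
    if "\<rho> \<in> hom \<Gamma> Homeo_plus" "lifts_hom K (\<rho> \<circ> i) \<rho>'" for \<rho> \<rho>'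
    using lifted_extension.is_translation_crossed_hom[OF loc[OF that]]
      lifted_extension.is_translation_crossed_hom_unique[OF loc[OF that]] by blast
  moreover have "crossed_hom_class G (H1_int K) (G_action K \<Gamma> i p) k =
      seven_term_phi K \<Gamma> G i p (euler_class_of \<Gamma> \<rho>)"
    if "\<rho> \<in> hom \<Gamma> Homeo_plus" "lifts_hom K (\<rho> \<circ> i) \<rho>'"
      "is_translation_crossed_hom K \<Gamma> G i p \<rho>' k" for \<rho> \<rho>' k
    using lifted_extension.translation_crossed_hom_class[OF loc[OF that(1,2)]]
      lifted_extension.is_translation_crossed_hom_unique[OF loc[OF that(1,2)] that(3)] by simp
  ultimately show ?thesis
    using lifts_hom_exists[OF K.is_monoid \<Gamma>.is_monoid i_hom] semi_conjugate_crossed_hom_class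
    by blast
qed

end
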